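(* For every integer $r$ with $1\le r\le 7$ (in particular for $r\in\{2,3,4,5,6,7\}$), $R(P;r)=r+6$.
   Context: All hypergraphs are 3-uniform (3-graphs). $P$ denotes the loose 3-uniform path of length 3: the 3-graph on 7 vertices $a,b,c,d,e,f,g$ with the 3 edges $\{a,b,c\},\{c,d,e\},\{e,f,g\}$. $K^3_n$ is the complete 3-graph on $n$ vertices (all 3-subsets are edges). For an integer $r\ge 1$, the Ramsey number $R(P;r)$ is the least integer $n$ such that every coloring of the edges of $K^3_n$ with $r$ colors contains a monochromatic copy of $P$. *)

theory Defs
  imports Main
begin

definition edges3 :: "nat \<Rightarrow> nat set set" where
  "edges3 n = {e. e \<subseteq> {..<n} \<and> card e = 3}"

definition colouring :: "nat \<Rightarrow> nat \<Rightarrow> (nat set \<Rightarrow> nat) \<Rightarrow> bool" where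
  "colouring n r c \<longleftrightarrow> (\<forall>e \<in> edges3 n. c e < r)"

definition mono_P :: "nat \<Rightarrow> (nat set \<Rightarrow> nat) \<Rightarrow> bool" where
  "mono_P n col \<longleftrightarrow> (\<exists>a b c d e f g.
      distinct [a, b, c, d, e, f, g] \<and> set [a, b, c, d, e, f, g] \<subseteq> {..<n} \<and>
      col {a, b, c} = col {c, d, e} \<and> col {c, d, e} = col {e, f, g})"

definition ramsey_P :: "nat \<Rightarrow> nat" where
  "ramsey_P r = (LEAST n. \<forall>col. colouring n r col \<longrightarrow> mono_P n col)"

end

(* Lower bound: colour an edge by its least vertex, capped at r - 1. Colours below r - 1 are stars
   and the last colour lives on six vertices.

   Upper bound, by induction on r: if some colour class is a star, delete its centre. Otherwise
   every class is P-free and not a star, and one needs a Turan type bound for such 3-graphs on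
   n = r + 6 vertices. Let C be the triangle {x2,x3,y1}, {x1,x3,y2}, {x1,x2,y3}.
   If a P-free 3-graph contains C, then no edge meets the six vertices of C in exactly one vertex,
   an outside vertex sees at most six pairs inside C, two outside vertices see at most six such
   pairs together, and if there is any, only 14 of the 20 triples inside C can be edges.
   If it is {P,C}-free, look at a vertex s of maximum degree and the edges t avoiding s. If an edge
   at s meets some t in one vertex, then almost all edges at s share a second vertex z; this heavy
   pair forbids almost all loose pairs among the edges avoiding s and z, so there are few of them.
   Otherwise s splits off the union of all t.
   The bounds beat the average class size except for n = 12, where two disjoint copies of K_6 have
   40 > 220/6 edges. There, counting forces all six classes to be of this form, and counting the
   triples through a fixed vertex gives a contradiction. *)

theory Submission
  imports Defs
begin

subsection \<open>3-graphs, loose paths and triangles\<close>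

definition triples :: "'a set \<Rightarrow> 'a set set" where
  "triples V = {e. e \<subseteq> V \<and> card e = 3}"

definition loose_path :: "'a set set \<Rightarrow> bool" where
  "loose_path H \<longleftrightarrow> (\<exists>a b c d e f g. distinct [a, b, c, d, e, f, g] \<and>
     {a, b, c} \<in> H \<and> {c, d, e} \<in> H \<and> {e, f, g} \<in> H)"

definition triangle :: "'a set set \<Rightarrow> 'a \<Rightarrow> 'a \<Rightarrow> 'a \<Rightarrow> 'a \<Rightarrow> 'a \<Rightarrow> 'a \<Rightarrow> bool" where
  "triangle H x1 x2 x3 y1 y2 y3 \<longleftrightarrow> distinct [x1, x2, x3, y1, y2, y3] \<and>
     {x2, x3, y1} \<in> H \<and> {x1, x3, y2} \<in> H \<and> {x1, x2, y3} \<in> H"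

definition triangle_free :: "'a set set \<Rightarrow> bool" where
  "triangle_free H \<longleftrightarrow> (\<forall>x1 x2 x3 y1 y2 y3. \<not> triangle H x1 x2 x3 y1 y2 y3)"

definition star_in :: "'a set \<Rightarrow> 'a set set \<Rightarrow> bool" where
  "star_in V H \<longleftrightarrow> (\<exists>v\<in>V. \<forall>e\<in>H. v \<in> e)"

abbreviation degree :: "'a set set \<Rightarrow> 'a \<Rightarrow> nat" where
  "degree H v \<equiv> card {e \<in> H. v \<in> e}"

abbreviation codegree :: "'a set set \<Rightarrow> 'a \<Rightarrow> 'a \<Rightarrow> nat" where
  "codegree H u v \<equiv> card {e \<in> H. u \<in> e \<and> v \<in> e}"

lemma finite_triples: "finite V \<Longrightarrow> finite (triples V)"
  by (simp add: triples_def)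

lemma card_triples: "finite V \<Longrightarrow> card (triples V) = card V choose 3"
  by (simp add: triples_def n_subsets)

lemma triplesD:
  assumes "H \<subseteq> triples V" "e \<in> H"
  shows "card e = 3" "finite e" "e \<subseteq> V"
proof -
  show "card e = 3" "e \<subseteq> V" using assms by (auto simp: triples_def)
  then show "finite e" by (metis card.infinite zero_neq_numeral)
qed

lemma card_le_choose: "finite V \<Longrightarrow> H \<subseteq> triples V \<Longrightarrow> card H \<le> card V choose 3"
  by (metis card_mono card_triples finite_triples)

lemma loose_path_mono: "loose_path H \<Longrightarrow> H \<subseteq> H' \<Longrightarrow> loose_path H'"
  unfolding loose_path_def by blast

lemma triangle_free_mono: "triangle_free H' \<Longrightarrow> H \<subseteq> H' \<Longrightarrow> triangle_free H"
  unfolding triangle_free_def triangle_def by blast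

lemma loose_pathI:
  "distinct [a, b, c, d, e, f, g] \<Longrightarrow> {a, b, c} \<in> H \<Longrightarrow> {c, d, e} \<in> H \<Longrightarrow> {e, f, g} \<in> H
    \<Longrightarrow> loose_path H"
  unfolding loose_path_def by blast

lemma card_3_memberE:
  assumes "card e = 3" "u \<in> e"
  obtains a b where "e = {u, a, b}" "distinct [u, a, b]"
proof -
  obtain x y z where "e = {x, y, z}" "x \<noteq> y" "y \<noteq> z" "x \<noteq> z"
    using assms(1) by (auto simp: card_3_iff)
  then show thesis using assms(2) that by (auto; metis insert_commute)
qed

lemma card_3_members2E:
  assumes "card e = 3" "u \<in> e" "v \<in> e" "u \<noteq> v"
  obtains a where "e = {u, v, a}" "distinct [u, v, a]"
proof -
  obtain a b where "e = {u, a, b}" "distinct [u, a, b]"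
    using card_3_memberE[OF assms(1,2)] by blast
  then show thesis using assms(3,4) that by (auto; metis insert_commute)
qed

text \<open>Lets paths be found from intersections alone, without naming all seven vertices.\<close>

lemma loose_path_sets:
  assumes "e \<in> H" "f \<in> H" "g \<in> H" "card e = 3" "card f = 3" "card g = 3"
    and "e \<inter> f = {u}" "f \<inter> g = {v}" "e \<inter> g = {}"
  shows "loose_path H"
proof -
  have "u \<noteq> v" using assms by blast
  obtain a b where e: "e = {u, a, b}" "distinct [u, a, b]"
    using card_3_memberE[OF assms(4), of u] assms by blast
  obtain c where f: "f = {u, v, c}" "distinct [u, v, c]"
    using card_3_members2E[OF assms(5), of u v] assms \<open>u \<noteq> v\<close> by blast
  obtain x y where g: "g = {v, x, y}" "distinct [v, x, y]"
    using card_3_memberE[OF assms(6), of v] assms by blast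
  show ?thesis
  proof (rule loose_pathI)
    show "distinct [a, b, u, c, v, x, y]" using assms(7-9) e f g by auto
    show "{a, b, u} \<in> H" "{u, c, v} \<in> H" "{v, x, y} \<in> H"
      using assms(1-3) e(1) f(1) g(1) by (simp_all add: insert_commute)
  qed
qed

lemma sum_degree:
  assumes "finite V" "H \<subseteq> triples V"
  shows "(\<Sum>v\<in>V. degree H v) = 3 * card H"
proof (rule sum_multicount)
  show "finite H" using assms finite_subset finite_triples by blast
  show "\<forall>e\<in>H. card {v \<in> V. v \<in> e} = 3"
  proof
    fix e assume "e \<in> H"
    then have "e \<subseteq> V" "card e = 3" using assms by (auto simp: triples_def)
    then have "{v \<in> V. v \<in> e} = e" by auto
    then show "card {v \<in> V. v \<in> e} = 3" using \<open>card e = 3\<close> by simp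
  qed
qed (use assms in auto)

lemma degree_le_choose:
  assumes "finite U" "s \<notin> U" "\<And>e. e \<in> S \<Longrightarrow> s \<in> e \<and> card e = 3 \<and> e - {s} \<subseteq> U"
  shows "card S \<le> card U choose 2"
proof -
  have "card S \<le> card {p. p \<subseteq> U \<and> card p = 2}"
  proof (rule card_inj_on_le[where f = "\<lambda>e. e - {s}"])
    show "inj_on (\<lambda>e. e - {s}) S"
      by (rule inj_onI) (metis assms(3) insert_Diff)
    show "(\<lambda>e. e - {s}) ` S \<subseteq> {p. p \<subseteq> U \<and> card p = 2}"
      using assms(3) by (auto simp: card_Diff_singleton)
  qed (simp add: assms(1))
  then show ?thesis by (simp add: n_subsets assms(1))
qed

lemma star_bound:
  assumes "finite V" "H \<subseteq> triples V" "star_in V H"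
  shows "card H \<le> (card V - 1) choose 2"
proof -
  obtain v where v: "v \<in> V" "\<forall>e\<in>H. v \<in> e" using assms(3) by (auto simp: star_in_def)
  have "card H \<le> card (V - {v}) choose 2"
    by (rule degree_le_choose[where s = v]) (use v assms in \<open>auto simp: triples_def\<close>)
  then show ?thesis using v by simp
qed

section \<open>3-graphs in which no two edges meet in exactly one vertex\<close>

lemma card_ge_2_inter:
  assumes "finite e" "A \<subseteq> e" "B \<subseteq> e" "card e = 3" "card A \<ge> 2" "card B \<ge> 2"
  shows "A \<inter> B \<noteq> {}"
proof
  assume "A \<inter> B = {}"
  then have "card (A \<union> B) = card A + card B"
    by (meson assms(1-3) card_Un_disjoint finite_subset)
  moreover have "card (A \<union> B) \<le> card e"
    using assms(1-3) by (intro card_mono) auto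
  ultimately show False using assms by simp
qed

text \<open>Edges that meet share at least two vertices, and two pairs inside a triple intersect, so
  the edges \<open>F\<close> meeting a fixed edge \<open>e\<close> are disjoint from all other
  edges. Either \<open>F\<close> lies on four vertices and has at most four edges, or each edge of
  \<open>F\<close> other than \<open>e\<close> brings its own vertex outside \<open>e\<close>.
  Induction removes \<open>F\<close> together with its span \<open>U\<close>.\<close>

lemma card_le_if_no_loose_pair:
  assumes "finite V" "H \<subseteq> triples V" "\<And>e f. e \<in> H \<Longrightarrow> f \<in> H \<Longrightarrow> card (e \<inter> f) \<noteq> 1"
  shows "card H \<le> card V"
  using assms
proof (induction "card V" arbitrary: V H rule: less_induct)
  case less
  note fin = less.prems(1) and sub = less.prems(2) and nl = less.prems(3)
  have finH: "finite H" using finite_subset[OF sub finite_triples[OF fin]] .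
  have c3: "card f = 3" "finite f" "f \<subseteq> V" if "f \<in> H" for f
    using triplesD[OF sub that] by auto
  show ?case
  proof (cases "H = {}")
    case False
    then obtain e where e: "e \<in> H" by blast
    define F where "F = {f \<in> H. f \<inter> e \<noteq> {}}"
    define U where "U = \<Union>F"
    have two: "card (f \<inter> g) \<ge> 2" if "f \<in> H" "g \<in> H" "f \<inter> g \<noteq> {}" for f g
      using nl[OF that(1,2)] that c3(2)[OF that(1)]
      by (metis One_nat_def Suc_1 card_0_eq finite_Int less_2_cases_iff not_le)
    have FH: "F \<subseteq> H" and eF: "e \<in> F" using e c3(1)[OF e] by (auto simp: F_def)
    have U: "U \<subseteq> V" "e \<subseteq> U" using FH eF c3(3) unfolding U_def by blast+
    have finU: "finite U" using U(1) fin finite_subset by blast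
    have "H - F \<subseteq> triples (V - U)"
    proof
      fix g assume g: "g \<in> H - F"
      have "g \<inter> U = {}"
      proof (rule ccontr)
        assume "g \<inter> U \<noteq> {}"
        then obtain f where f: "f \<in> F" "g \<inter> f \<noteq> {}" by (auto simp: U_def)
        have "(g \<inter> f) \<inter> (f \<inter> e) \<noteq> {}"
          by (rule card_ge_2_inter[where e = f]) (use f g FH F_def e c3 two in auto)
        then show False using g by (auto simp: F_def)
      qed
      then show "g \<in> triples (V - U)" using g c3(1,3)[of g] by (auto simp: triples_def)
    qed
    moreover have "card (V - U) < card V"
    proof -
      have "e \<noteq> {}" using c3(1)[OF e] by auto
      then have "V - U \<subset> V" using U by blast
      then show ?thesis using fin by (rule psubset_card_mono[rotated])
    qed
    ultimately have IH: "card (H - F) \<le> card (V - U)"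
      using less.hyps[of "V - U" "H - F"] nl fin by blast
    have pe: "card (f \<inter> e) = 2" if "f \<in> F" "f \<noteq> e" for f
    proof -
      have "card (f \<inter> e) \<ge> 2" using two that(1) e FH F_def by blast
      moreover have "card (f \<inter> e) \<noteq> 3"
        using c3[of f] c3[of e] that e FH
        by (metis Int_lower1 Int_lower2 card_subset_eq subsetD)
      moreover have "card (f \<inter> e) \<le> 3" using c3[OF e] by (metis Int_lower2 card_mono)
      ultimately show ?thesis by simp
    qed
    have out1: "card (f - e) = 1" if "f \<in> F" "f \<noteq> e" for f
      using pe[OF that] c3[of f] that(1) FH by (auto simp: card_Diff_subset_Int)
    have "card F \<le> card U"
    proof (cases "\<exists>x f g. f \<in> F \<and> g \<in> F \<and> f \<noteq> g \<and> x \<notin> e \<and> x \<in> f \<and> x \<in> g")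
      case True
      then obtain x f g where fg: "f \<in> F" "g \<in> F" "f \<noteq> g" "x \<notin> e" "x \<in> f" "x \<in> g" by blast
      have ne: "f \<noteq> e" "g \<noteq> e" using fg by auto
      have fx: "f - e = {x}" "g - e = {x}"
        using out1[OF fg(1) ne(1)] out1[OF fg(2) ne(2)] fg(4-6)
        by (metis DiffI card_1_singletonE singletonD)+
      have "F \<subseteq> triples (insert x e)"
      proof
        fix h assume h: "h \<in> F"
        \<comment> \<open>An edge \<open>h\<close> missing \<open>x\<close> meets \<open>f\<close>
          and \<open>g\<close> only inside \<open>e\<close>, each time in a pair; then
          \<open>f\<close> and \<open>g\<close> cut \<open>e\<close> in the same pair as
          \<open>h\<close> and coincide.\<close>
        have "h - e \<subseteq> {x}"
        proof (rule ccontr)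
          assume n: "\<not> h - e \<subseteq> {x}"
          then have he: "h \<noteq> e" by auto
          have xh: "x \<notin> h"
            using out1[OF h he] n fg(4) by (metis DiffI card_1_singletonE order_refl singletonD)
          have eq: "h \<inter> e = k \<inter> e" if k: "k \<in> F" "k \<noteq> e" "k - e = {x}" for k
          proof -
            have "(h \<inter> e) \<inter> (k \<inter> e) \<noteq> {}"
              by (rule card_ge_2_inter[where e = e]) (use pe h he k c3[OF e] in auto)
            then have "card (h \<inter> k) \<ge> 2" using two[of h k] h k FH by blast
            moreover have "h \<inter> k \<subseteq> e"
              using k(3) xh by (metis DiffI Int_iff singletonD subsetI)
            then have "h \<inter> k \<subseteq> h \<inter> e" "h \<inter> k \<subseteq> k \<inter> e" by auto
            ultimately have "h \<inter> k = h \<inter> e" "h \<inter> k = k \<inter> e"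
              using pe[OF h he] pe[OF k(1,2)] c3(2)[OF e] by (simp_all add: card_seteq)
            then show ?thesis by simp
          qed
          have "f \<inter> e = g \<inter> e" using eq[OF fg(1) ne(1) fx(1)] eq[OF fg(2) ne(2) fx(2)] by simp
          then show False using fx fg(3) by blast
        qed
        then show "h \<in> triples (insert x e)" using h FH c3(1)[of h] by (auto simp: triples_def)
      qed
      then have "card F \<le> card (insert x e) choose 3"
        using card_le_choose[of "insert x e" F] c3[OF e] by simp
      also have "\<dots> \<le> card (insert x e)"
        using c3[OF e] fg(4) by (simp add: numeral_eq_Suc)
      also have "\<dots> \<le> card U"
        by (rule card_mono[OF finU]) (use U fg U_def in auto)
      finally show ?thesis .
    next
      case False
      \<comment> \<open>The only vertex of \<open>f\<close> outside \<open>e\<close>; no two edges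
        of \<open>F\<close> share such a vertex, so \<open>z\<close> is injective.\<close>
      define z where "z f = (SOME x. x \<in> f - e)" for f
      have z: "z f \<in> f - e" if "f \<in> F - {e}" for f
      proof -
        have "card (f - e) = 1" using out1[of f] that by blast
        then have "f - e \<noteq> {}" by (metis card.empty zero_neq_one)
        then show ?thesis unfolding z_def by (meson ex_in_conv someI_ex)
      qed
      have "card (F - {e}) \<le> card (U - e)"
      proof (rule card_inj_on_le[where f = z])
        show "inj_on z (F - {e})"
        proof (rule inj_onI)
          fix f g assume "f \<in> F - {e}" "g \<in> F - {e}" "z f = z g"
          then show "f = g" using False z[of f] z[of g] by auto
        qed
        show "z ` (F - {e}) \<subseteq> U - e" using z by (auto simp: U_def)
      qed (use finU in simp)
      moreover have "card (F - {e}) = card F - 1" using eF by simp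
      moreover have "card (U - e) = card U - 3" "card U \<ge> 3"
        using U c3[OF e] finU card_mono[of U e] by (auto simp: card_Diff_subset)
      ultimately show ?thesis by linarith
    qed
    moreover have "card (V - U) = card V - card U" "card U \<le> card V"
      using U fin finU by (auto simp: card_Diff_subset card_mono)
    moreover have "card H = card F + card (H - F)"
      using FH finH by (metis card_Diff_subset card_mono finite_subset le_add_diff_inverse)
    ultimately show ?thesis using IH by linarith
  qed simp
qed

subsection \<open>The link of a vertex in a triangle-free 3-graph\<close>

lemma codegree_eq:
  assumes sub: "H \<subseteq> triples V" and sz: "s \<noteq> z"
  shows "{y. {s, z, y} \<in> H} \<subseteq> V - {s, z}" and "codegree H s z = card {y. {s, z, y} \<in> H}"
proof -
  note tr = triplesD[OF sub]
  show *: "{y. {s, z, y} \<in> H} \<subseteq> V - {s, z}"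
  proof
    fix y assume "y \<in> {y. {s, z, y} \<in> H}"
    then have y: "{s, z, y} \<in> H" by simp
    then have "y \<noteq> s" "y \<noteq> z" using tr(1)[OF y] sz by (auto simp: card_insert_if)
    then show "y \<in> V - {s, z}" using tr(3)[OF y] by auto
  qed
  have "{e \<in> H. s \<in> e \<and> z \<in> e} = (\<lambda>y. {s, z, y}) ` {y. {s, z, y} \<in> H}"
    using tr(1) sz by (auto elim!: card_3_members2E[of _ s z])
  moreover have "inj_on (\<lambda>y. {s, z, y}) {y. {s, z, y} \<in> H}"
    using * by (intro inj_onI) (auto simp: doubleton_eq_iff)
  ultimately show "codegree H s z = card {y. {s, z, y} \<in> H}" by (simp add: card_image)
qed

lemma codegree_le:
  assumes "finite V" "H \<subseteq> triples V" "s \<in> V" "z \<in> V" "s \<noteq> z"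
  shows "codegree H s z \<le> card V - 2"
proof -
  have "codegree H s z \<le> card (V - {s, z})"
    unfolding codegree_eq(2)[OF assms(2,5)]
    by (rule card_mono[OF _ codegree_eq(1)[OF assms(2,5)]]) (use assms(1) in simp)
  then show ?thesis using assms by (simp add: card_Diff_subset)
qed

text \<open>\<open>Y\<close> holds the third vertices of the edges through \<open>s\<close> and
  \<open>z\<close>, and \<open>N\<close> the remaining vertices. If two edges avoiding
  \<open>s\<close> and \<open>z\<close> meet only in \<open>v\<close>, another vertex
  \<open>y\<close> of theirs in \<open>Y\<close> would give a loose path starting with
  \<open>{s, z, y}\<close>; so their four other vertices lie in \<open>N\<close>. If
  \<open>N\<close> has at most three vertices, there is no such pair of edges. If it has four,
  deleting one of them destroys all such pairs at the cost of at most \<open>D\<close>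
  edges.\<close>

lemma heavy_pair_bound:
  assumes fin: "finite V" and sub: "H \<subseteq> triples V" and P: "\<not> loose_path H"
    and sz: "s \<in> V" "z \<in> V" "s \<noteq> z"
    and deg: "\<And>v. v \<in> V \<Longrightarrow> degree H v \<le> D" and D: "D \<le> codegree H s z + 3"
  shows "card V \<le> codegree H s z + 5 \<Longrightarrow> card H \<le> D + card V + 1"
    and "card V = codegree H s z + 6 \<Longrightarrow> card H \<le> 2 * D + card V"
proof -
  note tr = triplesD[OF sub]
  have finH: "finite H" using finite_subset[OF sub finite_triples[OF fin]] .
  define Y where "Y = {y. {s, z, y} \<in> H}"
  define N where "N = V - {s, z} - Y"
  define G where "G = {e \<in> H. s \<notin> e \<and> z \<notin> e}"
  have YV: "Y \<subseteq> V - {s, z}" and k: "codegree H s z = card Y"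
    unfolding Y_def by (rule codegree_eq[OF sub sz(3)])+
  have finN: "finite N" using fin by (simp add: N_def)
  have "card (V - {s, z}) = card V - 2" using sz fin by (simp add: card_Diff_subset)
  moreover have "card (V - {s, z} - Y) = card (V - {s, z}) - card Y"
    using YV fin by (meson card_Diff_subset finite_Diff finite_subset)
  ultimately have cN: "card N = card V - 2 - card Y" by (simp add: N_def)
  have "card {s, z} \<le> card V" using sz fin by (intro card_mono) auto
  then have V2: "card V \<ge> 2" using sz(3) by simp
  have loose: "(e \<union> f) - (e \<inter> f) \<subseteq> N \<and> card ((e \<union> f) - (e \<inter> f)) = 4"
    if ef: "e \<in> G" "f \<in> G" "card (e \<inter> f) = 1" for e f
  proof -
    have ef': "e \<in> H" "f \<in> H" using ef by (auto simp: G_def)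
    obtain v where v: "e \<inter> f = {v}" using ef(3) by (auto simp: card_1_singleton_iff)
    have no: False if yy: "y \<in> Y" "y \<in> a" "y \<noteq> v" "a \<in> G" "b \<in> G" "a \<inter> b = {v}" for y a b
    proof -
      have y: "{s, z, y} \<in> H" using yy(1) by (simp add: Y_def)
      have "loose_path H"
        by (rule loose_path_sets[of "{s, z, y}" H a b y v])
          (use yy y tr in \<open>auto simp: G_def\<close>)
      then show False using P by simp
    qed
    have "card (e \<union> f) + card (e \<inter> f) = card e + card f"
      using card_Un_Int tr(2) ef' by metis
    then have "card (e \<union> f) = 5" using tr(1) ef' ef(3) by simp
    moreover have "v \<in> e \<union> f" using v by blast
    ultimately have "card ((e \<union> f) - (e \<inter> f)) = 4" using v by (simp add: card_Diff_singleton)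
    moreover have "(e \<union> f) - (e \<inter> f) \<subseteq> N"
      using no[of _ e f] no[of _ f e] v ef tr(3)[OF ef'(1)] tr(3)[OF ef'(2)]
      by (auto simp: N_def G_def Int_commute)
    ultimately show ?thesis by simp
  qed
  have GV: "G \<subseteq> triples (V - {s, z})" using tr by (auto simp: G_def triples_def)
  define R where "R = {e \<in> H. s \<in> e} \<union> {e \<in> H. z \<in> e}"
  \<comment> \<open>Inclusion-exclusion: at most \<open>2 * D - codegree H s z\<close> edges meet
    \<open>{s, z}\<close>, and \<open>D\<close> exceeds the codegree by at most 3.\<close>
  have "card R + codegree H s z = degree H s + degree H z"
  proof -
    have "{e \<in> H. s \<in> e} \<inter> {e \<in> H. z \<in> e} = {e \<in> H. s \<in> e \<and> z \<in> e}" by auto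
    then show ?thesis
      using card_Un_Int[of "{e \<in> H. s \<in> e}" "{e \<in> H. z \<in> e}"] finH by (simp add: R_def)
  qed
  then have R: "card R \<le> D + 3" using deg[OF sz(1)] deg[OF sz(2)] D by linarith
  have "R \<union> G = H" by (auto simp: R_def G_def)
  then have HRG: "card H \<le> card R + card G" using card_Un_le[of R G] by simp
  show "card H \<le> D + card V + 1" if "card V \<le> codegree H s z + 5"
  proof -
    have "card G \<le> card (V - {s, z})"
    proof (rule card_le_if_no_loose_pair[OF _ GV])
      fix e f assume ef: "e \<in> G" "f \<in> G"
      show "card (e \<inter> f) \<noteq> 1"
      proof
        assume "card (e \<inter> f) = 1"
        then have "4 \<le> card N" using loose[OF ef] card_mono[OF finN] by metis
        then show False using that cN k by simp
      qed
    qed (use fin in simp)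
    then show ?thesis using HRG R \<open>card (V - {s, z}) = card V - 2\<close> V2 by linarith
  qed
  show "card H \<le> 2 * D + card V" if "card V = codegree H s z + 6"
  proof -
    have N4: "card N = 4" using that cN k by simp
    then obtain x where x: "x \<in> N" by fastforce
    define G' where "G' = {e \<in> G. x \<notin> e}"
    have "card G' \<le> card (V - {s, z, x})"
    proof (rule card_le_if_no_loose_pair)
      show "G' \<subseteq> triples (V - {s, z, x})" using GV by (auto simp: G'_def triples_def)
      fix e f assume ef: "e \<in> G'" "f \<in> G'"
      show "card (e \<inter> f) \<noteq> 1"
      proof
        assume "card (e \<inter> f) = 1"
        then have "(e \<union> f) - (e \<inter> f) = N"
          using loose[of e f] ef N4 finN by (metis (no_types, lifting) G'_def card_subset_eq mem_Collect_eq)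
        then show False using x ef by (auto simp: G'_def)
      qed
    qed (use fin in simp)
    also have "card (V - {s, z, x}) = card V - 3"
      using x sz fin by (subst card_Diff_subset) (auto simp: N_def)
    finally have "card G' \<le> card V - 3" .
    moreover have "card G \<le> card G' + degree H x"
    proof -
      have "G \<subseteq> G' \<union> {e \<in> H. x \<in> e}" by (auto simp: G_def G'_def)
      then have "card G \<le> card (G' \<union> {e \<in> H. x \<in> e})"
        using finH by (intro card_mono) (auto simp: G_def G'_def)
      then show ?thesis by (meson card_Un_le le_trans)
    qed
    moreover have "degree H x \<le> D" using x deg by (auto simp: N_def)
    ultimately show ?thesis using HRG R that by linarith
  qed
qed

lemma card_pairs_3: "card t = 3 \<Longrightarrow> card {p. p \<subseteq> t \<and> card p = 2} = 3"
proof -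
  assume t: "card t = 3"
  then have "finite t" by (metis card.infinite zero_neq_numeral)
  then show ?thesis using t by (simp add: n_subsets numeral_eq_Suc)
qed

text \<open>An edge at \<open>s\<close> that meets \<open>t\<close> in one vertex has the form
  \<open>{s, a, z}\<close> with \<open>a\<close> in \<open>t\<close>. Without loose paths, an edge
  at \<open>s\<close> disjoint from \<open>t\<close> contains \<open>z\<close>; without triangles,
  two crossing edges agree in their vertex on \<open>t\<close> or in their vertex off
  \<open>t\<close> other than \<open>s\<close>. Hence all crossing edges share a vertex besides
  \<open>s\<close>, and few other edges at \<open>s\<close> can miss it.\<close>

lemma crossing_heavy:
  assumes fin: "finite V" and sub: "H \<subseteq> triples V" and P: "\<not> loose_path H" and C: "triangle_free H"
    and t: "t \<in> H" "s \<notin> t" and e: "e \<in> H" "s \<in> e" "card (e \<inter> t) = 1"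
  shows "\<exists>z\<in>V. z \<noteq> s \<and> degree H s \<le> codegree H s z + 3"
proof -
  note tr = triplesD[OF sub]
  have finH: "finite H" using finite_subset[OF sub finite_triples[OF fin]] .
  have crossE: "\<exists>a z. f = {s, a, z} \<and> f \<inter> t = {a} \<and> distinct [s, a, z] \<and> z \<notin> t"
    if f: "f \<in> H" "s \<in> f" "card (f \<inter> t) = 1" for f
  proof -
    obtain a where a: "f \<inter> t = {a}" using f(3) by (auto simp: card_1_singleton_iff)
    then have "a \<in> f" "a \<noteq> s" using t(2) by auto
    then obtain z where z: "f = {s, a, z}" "distinct [s, a, z]"
      using card_3_members2E[OF tr(1)[OF f(1)] f(2), of a] by blast
    then have "z \<in> f" by simp
    then have "z \<notin> t" using a z(2) by (metis IntI distinct_length_2_or_more singletonD)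
    with z(1) a z(2) have "f = {s, a, z} \<and> f \<inter> t = {a} \<and> distinct [s, a, z] \<and> z \<notin> t"
      by (intro conjI)
    then show ?thesis by blast
  qed
  have outside: "z \<in> f" if f: "f \<in> H" "s \<in> f" "f \<inter> t = {}"
    and z: "{s, a, z} \<in> H" "{s, a, z} \<inter> t = {a}" for f a z
  proof (rule ccontr)
    assume "z \<notin> f"
    then have "{s, a, z} \<inter> f = {s}" "t \<inter> {s, a, z} = {a}" "t \<inter> f = {}" using f z by auto
    then have "loose_path H"
      by (intro loose_path_sets[of t H "{s, a, z}" f a s] tr(1) t(1) z(1) f(1))
    then show False using P by simp
  qed
  have agree: "a = a' \<or> z = z'"
    if z: "{s, a, z} \<in> H" "{s, a, z} \<inter> t = {a}" "distinct [s, a, z]" "z \<notin> t"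
    and z': "{s, a', z'} \<in> H" "{s, a', z'} \<inter> t = {a'}" "distinct [s, a', z']" "z' \<notin> t" for a z a' z'
  proof (rule ccontr)
    assume ne: "\<not> (a = a' \<or> z = z')"
    have "a \<in> t" "a' \<in> t" using z(2) z'(2) by auto
    then obtain b where b: "t = {a, a', b}" "distinct [a, a', b]"
      using card_3_members2E[OF tr(1)[OF t(1)], of a a'] ne by blast
    have "distinct [s, a, a', b, z', z]" using b ne z(2-4) z'(2-4) t(2) by auto
    then have "triangle H s a a' b z' z"
      unfolding triangle_def using b(1) z(1) z'(1) t(1) by simp
    then show False using C by (auto simp: triangle_free_def)
  qed
  have meets: "f \<inter> t = {} \<or> card (f \<inter> t) = 1 \<or> card (f \<inter> t) = 2 \<and> f = insert s (f \<inter> t)"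
    if f: "f \<in> H" "s \<in> f" for f
  proof -
    have "card (f \<inter> t) \<le> card (f - {s})"
      by (rule card_mono) (use t f tr in auto)
    moreover have c: "card (f - {s}) = 2" using f tr(1)[OF f(1)] tr(2)[OF f(1)] by simp
    moreover have "f \<inter> t = f - {s}" if "card (f \<inter> t) = 2"
      by (rule card_subset_eq) (use t f tr c that in auto)
    moreover have "finite (f \<inter> t)" using tr(2)[OF f(1)] by simp
    then have "card (f \<inter> t) = 0 \<Longrightarrow> f \<inter> t = {}" by simp
    moreover have "f = insert s (f \<inter> t)" if "f \<inter> t = f - {s}" using that f(2) by blast
    ultimately show ?thesis by (metis One_nat_def Suc_1 le_Suc_eq le_zero_eq)
  qed
  obtain a z where az: "e = {s, a, z}" "e \<inter> t = {a}" "distinct [s, a, z]" "z \<notin> t"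
    using crossE[OF e] by blast
  have az': "{s, a, z} \<in> H" "{s, a, z} \<inter> t = {a}" using az(1,2) e(1) by simp_all
  have zV: "z \<in> V" and aV: "a \<in> V" using az(1) tr(3)[OF e(1)] by blast+
  show ?thesis
  proof (cases "\<forall>f\<in>H. s \<in> f \<and> card (f \<inter> t) = 1 \<longrightarrow> z \<in> f")
    case True
    \<comment> \<open>The only edges at \<open>s\<close> that can miss \<open>z\<close> consist of
      \<open>s\<close> and one of the three pairs of \<open>t\<close>; hence the 3 in the
      conclusion.\<close>
    define Q where "Q = insert s ` {p. p \<subseteq> t \<and> card p = 2}"
    have "{f \<in> H. s \<in> f} \<subseteq> {f \<in> H. s \<in> f \<and> z \<in> f} \<union> Q"
    proof
      fix f assume f: "f \<in> {f \<in> H. s \<in> f}"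
      then consider "f \<inter> t = {}" | "card (f \<inter> t) = 1" | "card (f \<inter> t) = 2" "f = insert s (f \<inter> t)"
        using meets[of f] by blast
      then show "f \<in> {f \<in> H. s \<in> f \<and> z \<in> f} \<union> Q"
      proof cases
        case 1
        then have "z \<in> f" using outside[of f a z] f az' by blast
        then show ?thesis using f by blast
      next
        case 2
        then show ?thesis using True f by auto
      next
        case 3
        have "f \<inter> t \<in> {p. p \<subseteq> t \<and> card p = 2}" using 3(1) by blast
        then have "insert s (f \<inter> t) \<in> Q" unfolding Q_def by (rule imageI)
        then show ?thesis using 3(2) by (metis UnI2)
      qed
    qed
    moreover have "finite Q" "card Q \<le> 3"
    proof -
      have "finite {p. p \<subseteq> t \<and> card p = 2}" using tr(2)[OF t(1)] by simp
      then show "finite Q" "card Q \<le> 3"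
        unfolding Q_def using card_image_le[of "{p. p \<subseteq> t \<and> card p = 2}" "insert s"]
          card_pairs_3[OF tr(1)[OF t(1)]] by auto
    qed
    ultimately have "degree H s \<le> card ({f \<in> H. s \<in> f \<and> z \<in> f} \<union> Q)"
      using finH by (intro card_mono) auto
    also have "\<dots> \<le> codegree H s z + card Q" by (rule card_Un_le)
    finally show ?thesis using \<open>card Q \<le> 3\<close> zV az(3) by (intro bexI[of _ z]) auto
  next
    case False
    then obtain f where f: "f \<in> H" "s \<in> f" "card (f \<inter> t) = 1" "z \<notin> f" by blast
    obtain a' z' where f': "f = {s, a', z'}" "f \<inter> t = {a'}" "distinct [s, a', z']" "z' \<notin> t"
      using crossE[OF f(1-3)] by blast
    have zz: "z \<noteq> z'" using f(4) f'(1) by blast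
    have sf: "{s, a', z'} \<in> H" "{s, a', z'} \<inter> t = {a'}" using f(1) f'(1,2) by simp_all
    \<comment> \<open>A crossing edge without \<open>z\<close> must agree with \<open>e\<close> on
      \<open>t\<close>. A further crossing edge has to agree with both \<open>e\<close> and
      \<open>f\<close>, and since \<open>z\<close> and \<open>z'\<close> differ, it contains
      \<open>a\<close>.\<close>
    have "a' = a" using agree[OF az' az(3,4) sf f'(3,4)] zz by blast
    note f' = f'[unfolded this] and sf = sf[unfolded this]
    have ca: "a \<in> g" if g: "g \<in> H" "s \<in> g" "card (g \<inter> t) = 1" for g
    proof -
      obtain b y where b: "g = {s, b, y}" "g \<inter> t = {b}" "distinct [s, b, y]" "y \<notin> t"
        using crossE[OF g] by blast
      have sg: "{s, b, y} \<in> H" "{s, b, y} \<inter> t = {b}" using g(1) b(1,2) by simp_all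
      have "a = b" using agree[OF az' az(3,4) sg b(3,4)] agree[OF sf f'(3,4) sg b(3,4)] zz by blast
      then show ?thesis using b(1) by blast
    qed
    have "a \<in> t" using az(2) by blast
    then obtain b c where t': "t = {a, b, c}" "distinct [a, b, c]"
      using card_3_memberE[OF tr(1)[OF t(1)]] by blast
    \<comment> \<open>An edge at \<open>s\<close> disjoint from \<open>t\<close> contains both
      \<open>z\<close> and \<open>z'\<close>, so only two edges at \<open>s\<close> can miss
      \<open>a\<close>.\<close>
    have "{f \<in> H. s \<in> f} \<subseteq> {f \<in> H. s \<in> f \<and> a \<in> f} \<union> {{s, b, c}, {s, z, z'}}"
    proof
      fix g assume g: "g \<in> {f \<in> H. s \<in> f}"
      then consider "g \<inter> t = {}" | "card (g \<inter> t) = 1" | "card (g \<inter> t) = 2" "g = insert s (g \<inter> t)"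
        using meets[of g] by blast
      then show "g \<in> {f \<in> H. s \<in> f \<and> a \<in> f} \<union> {{s, b, c}, {s, z, z'}}"
      proof cases
        case 1
        then have "z \<in> g" "z' \<in> g" using outside[of g a z] outside[of g a z'] g az' sf by blast+
        then have "{s, z, z'} \<subseteq> g" using g by auto
        moreover have "card {s, z, z'} = card g" using tr(1)[of g] g zz az(3) f'(3) by simp
        ultimately have "{s, z, z'} = g" using tr(2)[of g] g by (intro card_subset_eq) auto
        then show ?thesis by blast
      next
        case 2
        then show ?thesis using ca g by blast
      next
        case 3
        show ?thesis
        proof (cases "a \<in> g")
          case False
          then have "g \<inter> t \<subseteq> {b, c}" using t'(1) by blast
          then have "g \<inter> t = {b, c}" using 3(1) t'(2) by (intro card_subset_eq) auto
          then have "g = {s, b, c}" using 3(2) by metis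
          then show ?thesis by blast
        qed (use g in blast)
      qed
    qed
    then have "degree H s \<le> card ({f \<in> H. s \<in> f \<and> a \<in> f} \<union> {{s, b, c}, {s, z, z'}})"
      using finH by (intro card_mono) auto
    also have "\<dots> \<le> codegree H s a + card {{s, b, c}, {s, z, z'}}" by (rule card_Un_le)
    also have "card {{s, b, c}, {s, z, z'}} \<le> 2" by (simp add: card_insert_if)
    finally show ?thesis using aV az(3) by (intro bexI[of _ a]) auto
  qed
qed

text \<open>Every edge at \<open>s\<close> that meets some \<open>t\<close> of \<open>T\<close>
  consists of \<open>s\<close> and a pair of \<open>t\<close>. If two edges at \<open>s\<close>
  share a vertex of some \<open>t\<close>, all edges meeting \<open>t\<close> lie in the four
  vertices \<open>insert s t\<close>. Otherwise the pairs cut out of \<open>W\<close> are disjoint,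
  so at most half of \<open>card W\<close> edges at \<open>s\<close> meet \<open>W\<close>; doubling
  avoids the fraction.\<close>

lemma no_crossing_bound:
  assumes fin: "finite V" and sub: "H \<subseteq> triples V" and s: "s \<in> V"
    and T: "T = {e \<in> H. s \<notin> e}" and W: "W = \<Union>T"
    and nc: "\<And>e t. e \<in> H \<Longrightarrow> s \<in> e \<Longrightarrow> t \<in> T \<Longrightarrow> card (e \<inter> t) \<noteq> 1"
  shows "(\<exists>t\<in>H. card {e \<in> H. e \<inter> t \<noteq> {}} \<le> 4)
    \<or> 2 * degree H s \<le> 2 * ((card V - 1 - card W) choose 2) + card W"
proof -
  note tr = triplesD[OF sub]
  have finH: "finite H" using finite_subset[OF sub finite_triples[OF fin]] .
  have WV: "W \<subseteq> V - {s}" using tr(3) by (auto simp: W T)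
  then have finW: "finite W" using fin finite_subset by blast
  have two: "card (e \<inter> t) = 2" "e = insert s (e \<inter> t)" if et: "e \<in> H" "s \<in> e" "t \<in> T" "e \<inter> t \<noteq> {}" for e t
  proof -
    have c: "card (e - {s}) = 2" using et tr(1)[OF et(1)] tr(2)[OF et(1)] by simp
    have st: "e \<inter> t \<subseteq> e - {s}" using et(3) T by auto
    have fe: "finite e" using tr(2)[OF et(1)] .
    then have "card (e \<inter> t) \<le> 2" using card_mono[OF _ st] c by simp
    moreover have "card (e \<inter> t) \<noteq> 0" using et(4) fe by simp
    ultimately show 1: "card (e \<inter> t) = 2" using nc[OF et(1-3)] by linarith
    have "e \<inter> t = e - {s}" using card_subset_eq[OF _ st] fe c 1 by simp
    then show "e = insert s (e \<inter> t)" using et(2) by auto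
  qed
  show ?thesis
  proof (cases "\<exists>v\<in>W. codegree H s v \<ge> 2")
    case True
    then obtain v where v: "v \<in> W" "codegree H s v \<ge> 2" by blast
    then obtain t where t: "t \<in> T" "v \<in> t" by (auto simp: W)
    have tH: "t \<in> H" "s \<notin> t" using t T by auto
    have "\<not> card {e \<in> H. s \<in> e \<and> v \<in> e} \<le> Suc 0" using v(2) by simp
    then obtain e1 e2 where e12: "e1 \<in> H" "s \<in> e1" "v \<in> e1" "e2 \<in> H" "s \<in> e2" "v \<in> e2" "e1 \<noteq> e2"
      using finH by (subst (asm) card_le_Suc0_iff_eq) auto
    have sv: "s \<noteq> v" using tH t by auto
    obtain u1 where u1: "e1 = {s, v, u1}" "distinct [s, v, u1]"
      using card_3_members2E[OF tr(1)[OF e12(1)] e12(2,3) sv] by blast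
    obtain u2 where u2: "e2 = {s, v, u2}" "distinct [s, v, u2]"
      using card_3_members2E[OF tr(1)[OF e12(4)] e12(5,6) sv] by blast
    have "e1 = insert s (e1 \<inter> t)" "e2 = insert s (e2 \<inter> t)"
      using two(2)[of e1 t] two(2)[of e2 t] e12 t by auto
    then have "e1 \<subseteq> insert s t" "e2 \<subseteq> insert s t" by blast+
    then have ut: "u1 \<in> t" "u2 \<in> t" using u1 u2 by auto
    have u12: "u1 \<noteq> u2" using u1 u2 e12(7) by auto
    have "{v, u1, u2} = t"
      by (rule card_subset_eq) (use ut t u12 u1 u2 tr[OF tH(1)] in auto)
    note teq = this[symmetric]
    have "{e \<in> H. e \<inter> t \<noteq> {}} \<subseteq> triples (insert s t)"
    proof
      fix f assume f: "f \<in> {e \<in> H. e \<inter> t \<noteq> {}}"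
      show "f \<in> triples (insert s t)"
      proof (cases "s \<in> f")
        case True
        then have "f = insert s (f \<inter> t)" using two(2)[of f t] f t by auto
        then have "f \<subseteq> insert s t" by blast
        then show ?thesis using tr(1)[of f] f by (simp add: triples_def)
      next
        case False
        then have fT: "f \<in> T" using f T by auto
        \<comment> \<open>An edge \<open>f\<close> of \<open>T\<close> that meets \<open>g\<close>
          contains the whole pair \<open>{v, u}\<close>. Used for \<open>e1\<close> and
          \<open>e2\<close>, this passes from any one vertex of \<open>t\<close> to all
          three.\<close>
        have both: "v \<in> f \<longleftrightarrow> u \<in> f" if u: "g = {s, v, u}" "g \<in> H" "distinct [s, v, u]" for g u
        proof -
          have "u \<in> g \<inter> f \<or> v \<in> g \<inter> f \<Longrightarrow> g \<subseteq> insert s f"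
            using two(2)[of g f] u fT by blast
          then show ?thesis using u by auto
        qed
        have "v \<in> f" "u1 \<in> f" "u2 \<in> f"
          using both[OF u1(1) e12(1) u1(2)] both[OF u2(1) e12(4) u2(2)] f teq by auto
        then have "t \<subseteq> f" using teq by auto
        then have "t = f" using card_subset_eq[of f t] tr f tH by auto
        then show ?thesis using tr(1)[of f] f by (auto simp: triples_def)
      qed
    qed
    then have "card {e \<in> H. e \<inter> t \<noteq> {}} \<le> card (insert s t) choose 3"
      using card_le_choose[of "insert s t"] tr(2)[OF tH(1)] by simp
    also have "\<dots> = 4" using tr(1,2)[OF tH(1)] tH(2) by (simp add: numeral_eq_Suc)
    finally show ?thesis using tH(1) by blast
  next
    case False
    define S1 where "S1 = {e \<in> H. s \<in> e \<and> e \<inter> W \<noteq> {}}"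
    define S0 where "S0 = {e \<in> H. s \<in> e \<and> e \<inter> W = {}}"
    have "(\<Sum>v\<in>W. card {e \<in> S1. v \<in> e}) = 2 * card S1"
    proof (rule sum_multicount[OF finW])
      show "finite S1" using finH by (simp add: S1_def)
      show "\<forall>e\<in>S1. card {v \<in> W. v \<in> e} = 2"
      proof
        fix e assume e: "e \<in> S1"
        then obtain t where t: "t \<in> T" "e \<inter> t \<noteq> {}" by (auto simp: S1_def W)
        have e': "e \<in> H" "s \<in> e" using e by (auto simp: S1_def)
        have 2: "card (e \<inter> t) = 2" and "e = insert s (e \<inter> t)" using two[OF e' t] .
        then have "e \<subseteq> insert s t" by blast
        then have "{v \<in> W. v \<in> e} = e \<inter> t" using t WV unfolding W by blast
        then show "card {v \<in> W. v \<in> e} = 2" using 2 by simp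
      qed
    qed
    moreover have "(\<Sum>v\<in>W. card {e \<in> S1. v \<in> e}) \<le> (\<Sum>v\<in>W. 1)"
    proof (rule sum_mono)
      fix v assume v: "v \<in> W"
      have "card {e \<in> S1. v \<in> e} \<le> codegree H s v"
        using finH by (intro card_mono) (auto simp: S1_def)
      then show "card {e \<in> S1. v \<in> e} \<le> 1" using False v by (force simp: not_le)
    qed
    ultimately have "2 * card S1 \<le> card W" by simp
    moreover have S0: "e - {s} \<subseteq> V - {s} - W" "s \<in> e" "card e = 3" if "e \<in> S0" for e
      using that tr(1,3)[of e] by (auto simp: S0_def)
    have "card S0 \<le> card (V - {s} - W) choose 2"
      by (rule degree_le_choose[where s = s]) (use fin S0 in auto)
    moreover have "card (V - {s} - W) = card V - 1 - card W"
      using WV finW s fin by (simp add: card_Diff_subset)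
    moreover have "degree H s \<le> card S0 + card S1"
    proof -
      have "{e \<in> H. s \<in> e} = S0 \<union> S1" by (auto simp: S0_def S1_def)
      then show ?thesis by (simp add: card_Un_le)
    qed
    ultimately show ?thesis by simp
  qed
qed

subsection \<open>Triangle-free 3-graphs without loose paths\<close>

text \<open>Not the extremal numbers: for \<open>n \<ge> 8\<close>, \<open>n \<noteq> 12\<close> the values are as large as averaging over
  \<open>n - 6\<close> colours permits.\<close>

definition nonstar_bound :: "nat \<Rightarrow> nat" where
  "nonstar_bound n = (if n = 7 then 20 else if n \<le> 9 then 27 else if n = 10 then 29
     else if n = 11 then 32 else if n = 12 then 35 else 40)"

text \<open>Covers stars and ground sets of at most six vertices too, since a deletion in the
  induction may leave either. The quotients are \<open>n choose 3\<close> and, for stars,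
  \<open>(n - 1) choose 2\<close>.\<close>

definition overall_bound :: "nat \<Rightarrow> nat" where
  "overall_bound n = (if n \<le> 6 then n * (n - 1) * (n - 2) div 6
     else max ((n - 1) * (n - 2) div 2) (nonstar_bound n))"

text \<open>Here \<open>w\<close> is the number of vertices covered by the edges avoiding a vertex \<open>s\<close> of
  maximum degree, and \<open>q\<close> bounds the degree of \<open>s\<close>.\<close>

lemma small_values_table:
  "\<forall>n\<in>set [7..<14]. 4 + overall_bound (n - 3) \<le> nonstar_bound n \<and>
     (\<forall>w\<in>set [3..<n]. let q = ((n - 1 - w) * (n - 2 - w) + w) div 2 in
       3 * (nonstar_bound n + 1) \<le> n * q \<longrightarrow> w \<le> 10 \<and> q + overall_bound w \<le> nonstar_bound n)"
  by code_simp

section \<open>Closed forms of binomial coefficients\<close>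

lemma six_choose_three: "6 * ((n + 2) choose 3) = (n + 2) * (n + 1) * n"
proof (induction n)
  case (Suc n)
  have "(Suc n + 2) choose 3 = ((n + 2) choose 2) + ((n + 2) choose 3)"
    by (simp add: numeral_3_eq_3 numeral_2_eq_2)
  moreover have "2 * ((n + 2) choose 2) = (n + 2) * (n + 1)"
    by (simp add: choose_two)
  ultimately show ?case using Suc by (simp add: algebra_simps)
qed (simp add: numeral_3_eq_3)

lemma choose_three: "n choose 3 = n * (n - 1) * (n - 2) div 6"
proof (cases "n < 2")
  case False
  then obtain m where "n = m + 2" by (metis add.commute le_Suc_ex not_le)
  then show ?thesis using six_choose_three[of m] by (simp add: algebra_simps)
qed (auto simp: less_2_cases_iff)

lemma choose_two_pred: "(n - 1) choose 2 = (n - 1) * (n - 2) div 2"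
  using choose_two[of "n - 1"] by (simp add: numeral_2_eq_2)

lemma two_choose_two: "2 * (n choose 2) = n * (n - 1)"
  by (cases n) (simp_all add: choose_two)

lemma overall_boundI:
  assumes "finite V" "H \<subseteq> triples V"
    and "7 \<le> card V \<Longrightarrow> \<not> star_in V H \<Longrightarrow> card H \<le> nonstar_bound (card V)"
  shows "card H \<le> overall_bound (card V)"
proof (cases "card V \<le> 6")
  case True
  then show ?thesis
    using card_le_choose[OF assms(1,2)] by (simp add: overall_bound_def choose_three)
next
  case False
  have "card H \<le> max ((card V - 1) choose 2) (nonstar_bound (card V))"
    using False assms(3) star_bound[OF assms(1,2)] by (cases "star_in V H") auto
  then show ?thesis using False by (simp only: overall_bound_def choose_two_pred if_False)
qed

text \<open>Assume one edge too many; averaging then bounds the maximum degree \<open>D\<close> from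
  below. An edge at \<open>s\<close> crossing an edge of \<open>T\<close> yields a heavy pair, whose
  bounds are too small or contradict the average. Otherwise induction applies to the edges disjoint
  from a triple that at most four edges meet, or to \<open>T\<close> on the vertex set
  \<open>W\<close>.\<close>

lemma triangle_free_bound:
  assumes "finite V" "H \<subseteq> triples V" "\<not> loose_path H" "triangle_free H"
    and "7 \<le> card V" "card V \<le> 13" "\<not> star_in V H"
  shows "card H \<le> nonstar_bound (card V)"
  using assms
proof (induction "card V" arbitrary: V H rule: less_induct)
  case less
  note fin = less.prems(1) and sub = less.prems(2) and P = less.prems(3) and C = less.prems(4)
  define n where "n = card V"
  have n: "7 \<le> n" "n \<le> 13" using less.prems by (auto simp: n_def)
  have nset: "n = 7 \<or> n = 8 \<or> n = 9 \<or> n = 10 \<or> n = 11 \<or> n = 12 \<or> n = 13" using n by linarith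
  have finH: "finite H" using finite_subset[OF sub finite_triples[OF fin]] .
  note tr = triplesD[OF sub]
  have IH: "card H' \<le> overall_bound (card V')"
    if "finite V'" "H' \<subseteq> triples V'" "H' \<subseteq> H" "card V' < n" for H' :: "'a set set" and V'
  proof (rule overall_boundI[OF that(1,2)])
    assume V': "7 \<le> card V'" "\<not> star_in V' H'"
    have "\<not> loose_path H'" "triangle_free H'"
      using P C that(3) loose_path_mono triangle_free_mono by blast+
    then show "card H' \<le> nonstar_bound (card V')"
      using less.hyps[OF _ that(1,2) _ _ V'(1) _ V'(2)] that(4) n by (simp add: n_def)
  qed
  show ?case
  proof (rule ccontr)
    assume "\<not> ?case"
    then have big: "nonstar_bound n + 1 \<le> card H" by (simp add: n_def)
    define D where "D = Max (degree H ` V)"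
    have Vne: "V \<noteq> {}" using n by (auto simp: n_def)
    then have "D \<in> degree H ` V" unfolding D_def using fin by (intro Max_in) auto
    then obtain s where s: "s \<in> V" "degree H s = D" by auto
    have degD: "degree H v \<le> D" if "v \<in> V" for v
      unfolding D_def using fin that by (intro Max_ge) auto
    have "3 * card H \<le> n * D"
    proof -
      have "3 * card H = (\<Sum>v\<in>V. degree H v)" by (rule sum_degree[OF fin sub, symmetric])
      also have "\<dots> \<le> card V * D" using sum_bounded_above[of V "degree H" D] degD by simp
      finally show ?thesis by (simp add: n_def)
    qed
    then have nD: "3 * (nonstar_bound n + 1) \<le> n * D"
      using mult_le_mono2[OF big, of 3] by (rule le_trans[rotated])
    define T where "T = {e \<in> H. s \<notin> e}"
    define W where "W = \<Union>T"
    obtain t0 where t0: "t0 \<in> T" using less.prems(7) s(1) by (auto simp: star_in_def T_def)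
    show False
    proof (cases "\<exists>e\<in>H. \<exists>t\<in>T. s \<in> e \<and> card (e \<inter> t) = 1")
      case True
      then obtain e t where et: "e \<in> H" "t \<in> T" "s \<in> e" "card (e \<inter> t) = 1" by blast
      have t: "t \<in> H" "s \<notin> t" using et by (auto simp: T_def)
      obtain z where z: "z \<in> V" "z \<noteq> s" "degree H s \<le> codegree H s z + 3"
        using crossing_heavy[OF fin sub P C t et(1,3,4)] by blast
      define k where "k = codegree H s z"
      have Dk: "D \<le> k + 3" using z s k_def by simp
      have kn: "k \<le> n - 2" using codegree_le[OF fin sub s(1) z(1)] z(2) by (simp add: k_def n_def)
      have h1: "n \<le> k + 5 \<Longrightarrow> card H \<le> D + n + 1"
        and h2: "n = k + 6 \<Longrightarrow> card H \<le> 2 * D + n"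
        using heavy_pair_bound[OF fin sub P s(1) z(1) z(2)[symmetric] degD] Dk
        by (auto simp: k_def n_def)
      \<comment> \<open>By \<open>D \<le> k + 3\<close> and \<open>k \<le> n - 2\<close> the first
        bound \<open>h1\<close> is at most \<open>2 * n + 2\<close>; for \<open>n = k + 6\<close>
        the second is at most \<open>3 * n - 6\<close>. For smaller \<open>k\<close>,
        \<open>D \<le> n - 4\<close> contradicts the average degree.\<close>
      have num: "2 * n + 2 \<le> nonstar_bound n" "3 * n \<le> nonstar_bound n + 6"
        "n * (n - 4) < 3 * (nonstar_bound n + 1)"
        using nset by (auto simp: nonstar_bound_def)
      have "k + 6 \<noteq> n" "\<not> n \<le> k + 5" using h1 h2 num(1,2) big Dk kn n by linarith+
      then have "D \<le> n - 4" using Dk by linarith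
      then have "n * D \<le> n * (n - 4)" by (rule mult_le_mono2)
      then show False using num(3) nD by linarith
    next
      case False
      have WV: "W \<subseteq> V - {s}" using tr(3) by (auto simp: W_def T_def)
      have finW: "finite W" using WV fin finite_subset by blast
      define w where "w = card W"
      have "t0 \<subseteq> W" using t0 by (auto simp: W_def)
      then have w3: "3 \<le> w" using tr(1)[of t0] t0 card_mono[OF finW, of t0] by (simp add: w_def T_def)
      have "w \<le> card (V - {s})" unfolding w_def using fin WV by (intro card_mono) auto
      then have wn: "w < n" using s(1) fin n by (simp add: n_def)
      have nc: "card (e \<inter> t) \<noteq> 1" if "e \<in> H" "s \<in> e" "t \<in> T" for e t
        using False that by blast
      have table: "4 + overall_bound (n - 3) \<le> nonstar_bound n"
        "let q = ((n - 1 - w) * (n - 2 - w) + w) div 2 in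
       3 * (nonstar_bound n + 1) \<le> n * q \<longrightarrow> w \<le> 10 \<and> q + overall_bound w \<le> nonstar_bound n"
      proof -
        have "n \<in> set [7..<14]" "w \<in> set [3..<n]"
          unfolding set_upt atLeastLessThan_iff using n w3 wn by simp_all
        then show "4 + overall_bound (n - 3) \<le> nonstar_bound n"
          "let q = ((n - 1 - w) * (n - 2 - w) + w) div 2 in
       3 * (nonstar_bound n + 1) \<le> n * q \<longrightarrow> w \<le> 10 \<and> q + overall_bound w \<le> nonstar_bound n"
          using small_values_table by blast+
      qed
      consider (a) t where "t \<in> H" "card {e \<in> H. e \<inter> t \<noteq> {}} \<le> 4"
        | (b) "2 * degree H s \<le> 2 * ((card V - 1 - card W) choose 2) + card W"
        using no_crossing_bound[OF fin sub s(1) T_def W_def nc] by blast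
      then show False
      proof cases
        case a
        define H' where "H' = {e \<in> H. e \<inter> t = {}}"
        have t3: "card t = 3" "t \<subseteq> V" using tr[OF a(1)] by auto
        have c: "card (V - t) = n - 3" using t3 tr(2)[OF a(1)] by (simp add: card_Diff_subset n_def)
        have "H' \<subseteq> triples (V - t)"
        proof
          fix e assume "e \<in> H'"
          then show "e \<in> triples (V - t)" using tr(1,3)[of e] by (auto simp: H'_def triples_def)
        qed
        then have "card H' \<le> overall_bound (n - 3)"
          using IH[of "V - t" H'] fin c n by (simp add: H'_def)
        moreover have "H' \<union> {e \<in> H. e \<inter> t \<noteq> {}} = H" by (auto simp: H'_def)
        then have "card H \<le> card H' + card {e \<in> H. e \<inter> t \<noteq> {}}"
          using card_Un_le[of H' "{e \<in> H. e \<inter> t \<noteq> {}}"] by simp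
        ultimately show False using a(2) table(1) big by linarith
      next
        case b
        define q where "q = ((n - 1 - w) * (n - 2 - w) + w) div 2"
        have "2 * ((n - 1 - w) choose 2) = (n - 1 - w) * (n - 2 - w)"
          using two_choose_two[of "n - 1 - w"] by (simp add: numeral_2_eq_2)
        then have "2 * D \<le> (n - 1 - w) * (n - 2 - w) + w" using b s(2) unfolding n_def w_def by linarith
        then have "D \<le> q" unfolding q_def by linarith
        then have "3 * (nonstar_bound n + 1) \<le> n * q" using nD
          by (meson le_trans mult_le_mono2)
        then have w10: "w \<le> 10" "q + overall_bound w \<le> nonstar_bound n"
          using table(2)[folded q_def] by (simp_all only: Let_def q_def[symmetric])
        have "T \<subseteq> triples W"
        proof
          fix e assume "e \<in> T"
          then show "e \<in> triples W" using tr(1)[of e] by (auto simp: T_def W_def triples_def)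
        qed
        then have "card T \<le> overall_bound w"
          using IH[of W T] finW wn by (simp add: w_def T_def)
        moreover have "{e \<in> H. s \<in> e} \<union> T = H" by (auto simp: T_def)
        then have "card H \<le> degree H s + card T"
          using card_Un_le[of "{e \<in> H. s \<in> e}" T] by simp
        ultimately show False using big w10(2) \<open>D \<le> q\<close> s(2) by linarith
      qed
    qed
  qed
qed

subsection \<open>3-graphs without loose paths that contain a triangle\<close>

text \<open>The corners \<open>x1, x2, x3\<close> are the pairwise intersections of the three edges, the foot
  \<open>yi\<close> lies on the edge opposite to \<open>xi\<close>. Lemmas named \<open>_rep\<close> treat one representative under
  the symmetries \<open>rot\<close> and \<open>swap\<close>.\<close>

locale triangle_config =
  fixes V :: "'a set" and H :: "'a set set" and x1 x2 x3 y1 y2 y3 :: 'a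
  assumes finite_V: "finite V" and H_triples: "H \<subseteq> triples V"
    and no_path: "\<not> loose_path H" and tri: "triangle H x1 x2 x3 y1 y2 y3"
begin

definition K :: "'a set" where "K = {x1, x2, x3, y1, y2, y3}"

text \<open>Two corners, or a corner with its own foot: the only pairs of \<open>K\<close> that can
  form an edge with an outside vertex. They are listed in three couples such as
  \<open>{x2, x3}\<close>, \<open>{x1, y1}\<close>, whose members cannot be linked to two different
  outside vertices.\<close>

definition link_pairs :: "'a set set" where
  "link_pairs = {{x2, x3}, {x1, y1}, {x1, x3}, {x2, y2}, {x1, x2}, {x3, y3}}"

definition link :: "'a \<Rightarrow> 'a set set" where "link v = {p \<in> link_pairs. insert v p \<in> H}"

definition linked :: "'a set" where "linked = {v \<in> V - K. link v \<noteq> {}}"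

lemma distinct_vertices: "distinct [x1, x2, x3, y1, y2, y3]"
  and edges: "{x2, x3, y1} \<in> H" "{x1, x3, y2} \<in> H" "{x1, x2, y3} \<in> H"
  using tri by (auto simp: triangle_def)

lemma edgeD: "e \<in> H \<Longrightarrow> card e = 3" "e \<in> H \<Longrightarrow> finite e" "e \<in> H \<Longrightarrow> e \<subseteq> V"
  using triplesD[OF H_triples] by auto

lemma K_sub: "K \<subseteq> V" and card_K: "card K = 6" and finite_K: "finite K"
  using edgeD(3)[OF edges(1)] edgeD(3)[OF edges(2)] edgeD(3)[OF edges(3)] distinct_vertices
  by (auto simp: K_def)

lemma finite_H: "finite H"
  using finite_subset[OF H_triples finite_triples[OF finite_V]] .

lemma no_pathD:
  "distinct [a, b, c, d, e, f, g] \<Longrightarrow> {a, b, c} \<in> H \<Longrightarrow> {c, d, e} \<in> H \<Longrightarrow> {e, f, g} \<in> H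
    \<Longrightarrow> False"
  using loose_pathI no_path by metis

end

lemma (in triangle_config) rot: "triangle_config V H x2 x3 x1 y2 y3 y1"
  using finite_V H_triples no_path tri by unfold_locales (auto simp: triangle_def insert_commute)

lemma (in triangle_config) swap: "triangle_config V H x2 x1 x3 y2 y1 y3"
  using finite_V H_triples no_path tri by unfold_locales (auto simp: triangle_def insert_commute)

lemma (in triangle_config) K_rot: "triangle_config.K x2 x3 x1 y2 y3 y1 = K"
  and K_swap: "triangle_config.K x2 x1 x3 y2 y1 y3 = K"
  unfolding K_def triangle_config.K_def[OF rot] triangle_config.K_def[OF swap] by auto

section \<open>Edges excluded by a triangle\<close>

context triangle_config
begin

text \<open>The triangle edges with feet \<open>y3\<close> and \<open>y1\<close> would continue such
  an edge to a loose path.\<close>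

lemma no_corner_foot_rep: "v \<notin> K \<Longrightarrow> {v, x1, y2} \<notin> H"
  using no_pathD[of v y2 x1 y3 x2 x3 y1] distinct_vertices edges by (auto simp: K_def insert_commute)

lemma no_two_feet_rep: "v \<notin> K \<Longrightarrow> {v, y1, y2} \<notin> H"
  using no_pathD[of v y2 y1 x3 x2 x1 y3] distinct_vertices edges by (auto simp: K_def insert_commute)

lemma no_two_outside_rep:
  assumes "v \<notin> K" "w \<notin> K" "v \<noteq> w"
  shows "{v, w, x1} \<notin> H" "{v, w, y1} \<notin> H"
  using no_pathD[of v w x1 y3 x2 x3 y1] no_pathD[of v w y1 x3 x2 x1 y3] distinct_vertices edges assms
  by (auto simp: K_def insert_commute)

text \<open>The edge outside \<open>K\<close>, the link at \<open>v\<close> and a triangle edge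
  through \<open>x1\<close> would form a loose path. Hence edges disjoint from \<open>K\<close>
  avoid linked vertices.\<close>

lemma no_three_outside_rep:
  assumes "v \<notin> K" "w \<notin> K" "u \<notin> K" "distinct [u, v, w]" "{u, w, v} \<in> H"
  shows "{v, x1, x2} \<notin> H" "{v, x1, y1} \<notin> H"
  using no_pathD[of u w v x2 x1 x3 y2] no_pathD[of u w v y1 x1 x2 y3] distinct_vertices edges assms
  by (auto simp: K_def insert_commute)

text \<open>The triangle edge \<open>{x1, x3, y2}\<close> would join the two links to a loose
  path.\<close>

lemma opposite_links_rep:
  assumes "v \<notin> K" "w \<notin> K" "v \<noteq> w"
  shows "\<not> ({v, x1, x2} \<in> H \<and> {w, x3, y3} \<in> H)"
  using no_pathD[of v x2 x1 y2 x3 y3 w] distinct_vertices edges assms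
  by (auto simp: K_def insert_commute)

text \<open>With \<open>rot\<close>, \<open>swap\<close> and the identity these are all six
  renumberings of the indices, so each representative excludes its whole orbit.\<close>

lemmas rot2 = triangle_config.rot[OF rot]
lemmas swap_rot = triangle_config.rot[OF swap]
lemmas swap_rot2 = triangle_config.rot[OF swap_rot]

lemma K_rot2: "triangle_config.K x3 x1 x2 y3 y1 y2 = K"
  and K_swap_rot: "triangle_config.K x1 x3 x2 y1 y3 y2 = K"
  and K_swap_rot2: "triangle_config.K x3 x2 x1 y3 y2 y1 = K"
  using triangle_config.K_rot[OF rot] triangle_config.K_rot[OF swap]
    triangle_config.K_rot[OF swap_rot] K_rot K_swap by simp_all

lemma no_corner_foot:
  assumes "v \<notin> K"
  shows "{v, x1, y2} \<notin> H" "{v, x2, y3} \<notin> H" "{v, x3, y1} \<notin> H"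
    "{v, x2, y1} \<notin> H" "{v, x1, y3} \<notin> H" "{v, x3, y2} \<notin> H"
  using no_corner_foot_rep triangle_config.no_corner_foot_rep[OF rot, unfolded K_rot]
    triangle_config.no_corner_foot_rep[OF rot2, unfolded K_rot2] triangle_config.no_corner_foot_rep[OF swap, unfolded K_swap]
    triangle_config.no_corner_foot_rep[OF swap_rot, unfolded K_swap_rot]
    triangle_config.no_corner_foot_rep[OF swap_rot2, unfolded K_swap_rot2] assms by blast+

lemma no_two_feet:
  assumes "v \<notin> K"
  shows "{v, y1, y2} \<notin> H" "{v, y2, y3} \<notin> H" "{v, y3, y1} \<notin> H"
  using no_two_feet_rep triangle_config.no_two_feet_rep[OF rot, unfolded K_rot]
    triangle_config.no_two_feet_rep[OF rot2, unfolded K_rot2] assms by blast+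

lemma no_two_outside:
  assumes "v \<notin> K" "w \<notin> K" "v \<noteq> w" "u \<in> K"
  shows "{v, w, u} \<notin> H"
  using no_two_outside_rep[OF assms(1-3)]
    triangle_config.no_two_outside_rep[OF rot, unfolded K_rot, OF assms(1-3)]
    triangle_config.no_two_outside_rep[OF rot2, unfolded K_rot2, OF assms(1-3)] assms(4)
  unfolding K_def by blast

text \<open>Of the fifteen pairs of \<open>K\<close>, six are link pairs; the nine in
  \<open>bad\<close> are excluded by \<open>no_corner_foot\<close> and
  \<open>no_two_feet\<close>.\<close>

lemma link_pair_if_edge:
  assumes "v \<notin> K" "a \<in> K" "b \<in> K" "a \<noteq> b" "{v, a, b} \<in> H"
  shows "{a, b} \<in> link_pairs"
proof -
  define bad where "bad = {{x1, y2}, {x2, y3}, {x3, y1}, {x2, y1}, {x1, y3}, {x3, y2},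
    {y1, y2}, {y2, y3}, {y3, y1}}"
  have "{a, b} \<in> link_pairs \<union> bad"
    using assms(2-4) unfolding K_def link_pairs_def bad_def by (elim insertE emptyE) (simp_all add: doubleton_eq_iff)
  moreover have "insert v p \<notin> H" if "p \<in> bad" for p
    using that no_corner_foot[OF assms(1)] no_two_feet[OF assms(1)] unfolding bad_def by (elim insertE emptyE) simp_all
  ultimately show ?thesis using assms(5) by blast
qed

lemma no_three_outside:
  assumes "v \<notin> K" "w \<notin> K" "u \<notin> K" "distinct [u, v, w]" "{u, w, v} \<in> H"
  shows "link v = {}"
proof -
  have "insert v p \<notin> H" if "p \<in> link_pairs" for p
    using no_three_outside_rep[OF assms]
      triangle_config.no_three_outside_rep[OF rot, unfolded K_rot, OF assms]
      triangle_config.no_three_outside_rep[OF rot2, unfolded K_rot2, OF assms] that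
    unfolding link_pairs_def by (auto simp: insert_commute)
  then show ?thesis by (auto simp: link_def)
qed

lemma opposite_links:
  assumes "v \<notin> K" "w \<notin> K" "v \<noteq> w"
  shows "\<not> ({x1, x2} \<in> link v \<and> {x3, y3} \<in> link w)" "\<not> ({x2, x3} \<in> link v \<and> {x1, y1} \<in> link w)"
    "\<not> ({x1, x3} \<in> link v \<and> {x2, y2} \<in> link w)"
  using opposite_links_rep[OF assms] triangle_config.opposite_links_rep[OF rot, unfolded K_rot, OF assms]
    triangle_config.opposite_links_rep[OF rot2, unfolded K_rot2, OF assms]
  by (auto simp: link_def insert_commute)

end

section \<open>Counting edges by their links\<close>

lemma card_Int_pair_sum:
  assumes "p \<noteq> q" "\<not> (p \<in> A \<and> q \<in> B)" "\<not> (p \<in> B \<and> q \<in> A)"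
  shows "card (A \<inter> {p, q}) + card (B \<inter> {p, q}) \<le> 2"
  using assms by (cases "p \<in> A"; cases "q \<in> A"; cases "p \<in> B"; cases "q \<in> B") auto

lemma card_le_Int_pairs:
  assumes "A \<subseteq> {a, b, c, d, e, f}"
  shows "card A \<le> card (A \<inter> {a, b}) + card (A \<inter> {c, d}) + card (A \<inter> {e, f})"
proof -
  have "A = (A \<inter> {a, b} \<union> A \<inter> {c, d}) \<union> A \<inter> {e, f}" using assms by blast
  then have "card A = card ((A \<inter> {a, b} \<union> A \<inter> {c, d}) \<union> A \<inter> {e, f})" by (rule arg_cong)
  then show ?thesis
    using card_Un_le[of "A \<inter> {a, b} \<union> A \<inter> {c, d}" "A \<inter> {e, f}"]
      card_Un_le[of "A \<inter> {a, b}" "A \<inter> {c, d}"] by linarith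
qed

text \<open>If some value exceeds 3, all others are at most 3; pairing the large value with any one
  of them restores the average.\<close>

lemma sum_le_if_pair_sums_le:
  fixes f :: "'a \<Rightarrow> nat"
  assumes "finite Y" "card Y \<ge> 2" "\<And>v w. v \<in> Y \<Longrightarrow> w \<in> Y \<Longrightarrow> v \<noteq> w \<Longrightarrow> f v + f w \<le> 6"
  shows "sum f Y \<le> 3 * card Y"
proof (cases "\<forall>v\<in>Y. f v \<le> 3")
  case True
  then show ?thesis using sum_bounded_above[of Y f 3] by simp
next
  case False
  then obtain v where v: "v \<in> Y" "f v > 3" by auto
  have "Y - {v} \<noteq> {}"
  proof
    assume "Y - {v} = {}"
    then have "Y \<subseteq> {v}" by blast
    then show False using assms(2) card_mono[of "{v}" Y] by simp
  qed
  then obtain w where w: "w \<in> Y" "w \<noteq> v" by blast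
  have "sum f Y = f v + (f w + sum f (Y - {v} - {w}))"
    using assms(1) v w by (simp add: sum.remove[of Y v] sum.remove[of "Y - {v}" w])
  moreover have "sum f (Y - {v} - {w}) \<le> card (Y - {v} - {w}) * 3"
  proof (rule sum_bounded_above[of _ f "3::nat", simplified])
    fix u assume "u \<in> Y - {v} - {w}"
    then show "f u \<le> 3" using assms(3)[of v u] v by force
  qed
  moreover have "card (Y - {v} - {w}) = card Y - 2" using v w assms(1) by simp
  moreover have "f v + f w \<le> 6" using assms(3)[OF v(1) w(1)] w(2) by simp
  ultimately show ?thesis using assms(2) by linarith
qed

context triangle_config
begin

lemma card_link_le_6: "card (link v) \<le> 6"
proof -
  have "card link_pairs \<le> 6"
  proof -
    define ps where "ps = [{x2, x3}, {x1, y1}, {x1, x3}, {x2, y2}, {x1, x2}, {x3, y3}]"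
    have "set ps = link_pairs" "length ps = 6" unfolding ps_def link_pairs_def by simp_all
    then show ?thesis using card_length[of ps] by simp
  qed
  moreover have "finite link_pairs" by (simp add: link_pairs_def)
  then have "card (link v) \<le> card link_pairs"
    unfolding link_def by (rule card_mono) (rule Collect_restrict)
  ultimately show ?thesis by simp
qed

text \<open>By \<open>opposite_links\<close>, each of the three couples of link pairs contributes at
  most 2 to the two links together.\<close>

lemma card_link_sum:
  assumes "v \<notin> K" "w \<notin> K" "v \<noteq> w"
  shows "card (link v) + card (link w) \<le> 6"
proof -
  have split: "card (link u) \<le> card (link u \<inter> {{x2, x3}, {x1, y1}}) + card (link u \<inter> {{x1, x3}, {x2, y2}})
      + card (link u \<inter> {{x1, x2}, {x3, y3}})" for u
    unfolding link_def link_pairs_def by (rule card_le_Int_pairs) (rule Collect_restrict)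
  have ne: "{x2, x3} \<noteq> {x1, y1}" "{x1, x3} \<noteq> {x2, y2}" "{x1, x2} \<noteq> {x3, y3}"
    using distinct_vertices by (auto simp: doubleton_eq_iff)
  note opp = opposite_links[OF assms] opposite_links[OF assms(2,1) assms(3)[symmetric]]
  show ?thesis
    using split[of v] split[of w]
      card_Int_pair_sum[OF ne(1) opp(2,5)] card_Int_pair_sum[OF ne(2) opp(3,6)]
      card_Int_pair_sum[OF ne(3) opp(1,4)] by linarith
qed

text \<open>Sorts the edges by their trace on \<open>K\<close>: three vertices lie inside, two come
  from a link, one is impossible by \<open>no_two_outside\<close>, and edges with empty trace avoid
  linked vertices by \<open>no_three_outside\<close>.\<close>

lemma H_cover:
  "H \<subseteq> (H \<inter> triples K) \<union> (\<Union>v\<in>linked. insert v ` link v) \<union> (H \<inter> triples (V - K - linked))"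
proof
  fix e assume e: "e \<in> H"
  note e3 = edgeD[OF e]
  show "e \<in> (H \<inter> triples K) \<union> (\<Union>v\<in>linked. insert v ` link v) \<union> (H \<inter> triples (V - K - linked))"
  proof (cases "e \<inter> K = {}")
    case True
    have "e \<inter> linked = {}"
    proof (rule ccontr)
      assume "e \<inter> linked \<noteq> {}"
      then obtain v where v: "v \<in> e" "v \<in> linked" by blast
      obtain u w where uw: "e = {v, u, w}" "distinct [v, u, w]"
        using card_3_memberE[OF e3(1) v(1)] by blast
      have "link v = {}"
        by (rule no_three_outside[of v w u]) (use True uw e in \<open>auto simp: insert_commute\<close>)
      then show False using v(2) by (simp add: linked_def)
    qed
    then have "e \<subseteq> V - K - linked" using True e3(3) by blast
    then show ?thesis using e e3(1) by (simp add: triples_def)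
  next
    case False
    then obtain u where u: "u \<in> e" "u \<in> K" by blast
    obtain a b where ab: "e = {u, a, b}" "distinct [u, a, b]"
      using card_3_memberE[OF e3(1) u(1)] by blast
    have one: ?thesis if vp: "v \<notin> K" "c \<in> K" "d \<in> K" "c \<noteq> d" "e = {v, c, d}" for v c d
    proof -
      have "{c, d} \<in> link v"
        using link_pair_if_edge[OF vp(1-4)] e vp(5) by (simp add: link_def)
      moreover have "v \<in> V" using e3(3) vp(5) by blast
      ultimately have "v \<in> linked" using vp(1) by (auto simp: linked_def)
      then show ?thesis using \<open>{c, d} \<in> link v\<close> vp(5) by blast
    qed
    have e': "e = {a, u, b}" "e = {b, u, a}" "e = {a, b, u}" using ab(1) by (simp_all add: insert_commute)
    consider "a \<in> K" "b \<in> K" | "a \<in> K" "b \<notin> K" | "a \<notin> K" "b \<in> K" | "a \<notin> K" "b \<notin> K" by blast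
    then show ?thesis
    proof cases
      case 1
      then have "e \<subseteq> K" using ab(1) u(2) by simp
      then show ?thesis using e e3(1) by (simp add: triples_def)
    next
      case 2
      then show ?thesis using one[of b u a] ab(2) u(2) e'(2) by simp
    next
      case 3
      then show ?thesis using one[of a u b] ab(2) u(2) e'(1) by simp
    next
      case 4
      then show ?thesis using no_two_outside[of a b u] ab(2) u(2) e e'(3) by simp
    qed
  qed
qed

lemma card_H_le:
  "card H \<le> card (H \<inter> triples K) + (\<Sum>v\<in>linked. card (link v)) + card (H \<inter> triples (V - K - linked))"
proof -
  have finY: "finite linked" using finite_V by (simp add: linked_def)
  have finL: "finite (link v)" for v by (simp add: link_def link_pairs_def)
  have "card H \<le> card ((H \<inter> triples K) \<union> (\<Union>v\<in>linked. insert v ` link v) \<union> (H \<inter> triples (V - K - linked)))"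
    by (rule card_mono[OF _ H_cover]) (use finite_H finY finL in simp)
  also have "\<dots> \<le> card (H \<inter> triples K) + card (\<Union>v\<in>linked. insert v ` link v) + card (H \<inter> triples (V - K - linked))"
    by (meson add_mono card_Un_le le_trans order_refl)
  also have "card (\<Union>v\<in>linked. insert v ` link v) \<le> (\<Sum>v\<in>linked. card (link v))"
  proof -
    have "card (\<Union>v\<in>linked. insert v ` link v) \<le> (\<Sum>v\<in>linked. card (insert v ` link v))"
      by (rule card_UN_le[OF finY])
    also have "\<dots> \<le> (\<Sum>v\<in>linked. card (link v))" by (intro sum_mono card_image_le finL)
    finally show ?thesis .
  qed
  finally show ?thesis by simp
qed

text \<open>An edge formed by an outside vertex and a pair \<open>x, y\<close> would join two complementary triples
  separating \<open>x\<close> from \<open>y\<close> to a loose path, so at most 6 of the 12 separating triples are edges.\<close>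

lemma card_inside_K:
  assumes "linked \<noteq> {}"
  shows "card (H \<inter> triples K) \<le> 14"
proof -
  obtain v p where v: "v \<in> linked" "p \<in> link v" using assms by (auto simp: linked_def)
  have vK: "v \<notin> K" using v(1) by (simp add: linked_def)
  have pL: "p \<in> link_pairs" and vp: "insert v p \<in> H" using v(2) by (auto simp: link_def)
  obtain x y where xy: "p = {x, y}" "x \<noteq> y" "x \<in> K" "y \<in> K"
    using pL distinct_vertices unfolding link_pairs_def K_def by auto
  define sep where "sep e \<longleftrightarrow> (x \<in> e \<longleftrightarrow> y \<notin> e)" for e
  define S where "S = {e \<in> H \<inter> triples K. sep e}"
  define S' where "S' = (\<lambda>e. K - e) ` S"
  define N where "N = {e \<in> triples K. \<not> sep e}"
  have finT: "finite (triples K)" using finite_triples[OF finite_K] .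
  have cT: "card (triples K) = 20" using card_triples[OF finite_K] card_K by (simp add: choose_three)
  have inj: "inj_on (\<lambda>e. K - e) S"
    by (rule inj_onI) (auto simp: S_def triples_def)
  have S'T: "S' \<subseteq> triples K - N"
  proof
    fix f assume "f \<in> S'"
    then obtain e where e: "f = K - e" "e \<in> S" by (auto simp: S'_def)
    then have "e \<subseteq> K" "card e = 3" "finite e" using finite_subset[OF _ finite_K] by (auto simp: S_def triples_def)
    then have "card f = 3" using e(1) card_K by (simp add: card_Diff_subset)
    moreover have "sep f" using e xy by (auto simp: S_def sep_def)
    ultimately show "f \<in> triples K - N" using e(1) by (auto simp: N_def triples_def)
  qed
  have disj: "S \<inter> S' = {}"
  proof (rule ccontr)
    assume "S \<inter> S' \<noteq> {}"
    then obtain e where e: "K - e \<in> H" "e \<in> S" by (auto simp: S_def S'_def)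
    have eH: "e \<in> H" "e \<subseteq> K" "sep e" using e(2) by (auto simp: S_def triples_def)
    obtain a b where ab: "p = {a, b}" "a \<in> e" "b \<notin> e" "b \<in> K"
      using eH(3) xy by (cases "x \<in> e") (auto simp: sep_def insert_commute)
    have "loose_path H"
    proof (rule loose_path_sets[of e H "insert v p" "K - e" a b])
      show "e \<inter> insert v p = {a}" using ab eH vK by auto
      show "insert v p \<inter> (K - e) = {b}" using ab eH vK by auto
    qed (use edgeD(1) e(1) eH(1) vp in auto)
    then show False using no_path by simp
  qed
  \<comment> \<open>Four of the non-separating triples avoid \<open>x\<close> and \<open>y\<close>,
    four contain both. With \<open>2 * card S \<le> 20 - card N\<close> this makes
    \<open>card S + card N\<close> at most 14.\<close>
  have "card N \<le> 8"
  proof -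
    define R where "R = K - {x, y}"
    have "card (K - {x, y}) = card K - card {x, y}"
      by (rule card_Diff_subset) (use xy in auto)
    then have R: "card R = 4" "finite R" using xy(2) card_K finite_K by (simp_all add: R_def)
    have "N \<subseteq> triples R \<union> (\<lambda>z. {x, y, z}) ` R"
    proof
      fix e assume "e \<in> N"
      then have e: "e \<subseteq> K" "card e = 3" "x \<in> e \<longleftrightarrow> y \<in> e" by (auto simp: N_def triples_def sep_def)
      show "e \<in> triples R \<union> (\<lambda>z. {x, y, z}) ` R"
      proof (cases "x \<in> e")
        case True
        then obtain z where z: "e = {x, y, z}" "distinct [x, y, z]"
          using card_3_members2E[OF e(2) True] e(3) xy(2) by blast
        then have "z \<in> R" using e(1) by (auto simp: R_def)
        then show ?thesis using z(1) by blast
      next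
        case False
        then show ?thesis using e by (auto simp: triples_def R_def)
      qed
    qed
    then have "card N \<le> card (triples R \<union> (\<lambda>z. {x, y, z}) ` R)"
      by (rule card_mono[rotated]) (use R finite_triples in auto)
    also have "\<dots> \<le> card (triples R) + card ((\<lambda>z. {x, y, z}) ` R)" by (rule card_Un_le)
    also have "card (triples R) = 4" using card_triples[OF R(2)] R(1) by (simp add: choose_three)
    also have "card ((\<lambda>z. {x, y, z}) ` R) \<le> 4" using card_image_le[OF R(2)] R(1) by metis
    finally show ?thesis by simp
  qed
  moreover have "card S + card S' \<le> 20 - card N"
  proof -
    have "card (S \<union> S') \<le> card (triples K - N)"
      using S'T finT by (intro card_mono) (auto simp: S_def N_def)
    moreover have "card (S \<union> S') = card S + card S'"
      by (rule card_Un_disjoint[OF _ _ disj]) (use finT in \<open>auto simp: S_def S'_def\<close>)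
    moreover have "card (triples K - N) = 20 - card N"
      using finT cT by (subst card_Diff_subset) (auto simp: N_def)
    ultimately show ?thesis by simp
  qed
  moreover have "card S' = card S" unfolding S'_def by (rule card_image[OF inj])
  moreover have "card N \<le> 20" using cT finT card_mono[of "triples K" N] by (simp add: N_def)
  moreover have "card (H \<inter> triples K) \<le> card S + card N"
  proof -
    have "H \<inter> triples K \<subseteq> S \<union> N" by (auto simp: S_def N_def)
    then have "card (H \<inter> triples K) \<le> card (S \<union> N)"
      using finT by (intro card_mono) (auto simp: S_def N_def)
    then show ?thesis using card_Un_le[of S N] by linarith
  qed
  ultimately show ?thesis by linarith
qed

end

lemma card_Int_triples_le: "finite Z \<Longrightarrow> card (H \<inter> triples Z) \<le> card Z choose 3"
  by (rule card_le_choose) auto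

context triangle_config
begin

lemma split_if_no_links: "linked = {} \<Longrightarrow> H \<subseteq> triples K \<union> triples (V - K)"
  using H_cover by auto

lemma card_outside: "card (V - K - linked) + card linked + 6 = card V"
proof -
  have "linked \<subseteq> V - K" "finite linked" using finite_V by (auto simp: linked_def)
  then have "card (V - K - linked) + card linked = card (V - K)"
    using finite_V card_mono[of "V - K" linked] by (simp add: card_Diff_subset)
  moreover have "card (V - K) + 6 = card V"
    using K_sub finite_K finite_V card_K card_mono[OF finite_V K_sub] by (simp add: card_Diff_subset)
  ultimately show ?thesis by simp
qed

lemma card_H_le_if_one_link: "card linked = 1 \<Longrightarrow> card H \<le> 20 + card (H \<inter> triples (V - K - linked))"
proof -
  assume 1: "card linked = 1"
  then obtain v where v: "linked = {v}" by (auto simp: card_1_singleton_iff)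
  then show ?thesis using card_H_le card_inside_K card_link_le_6[of v] by simp
qed

lemma card_H_le_if_links:
  assumes "card linked \<ge> 2"
  shows "card H \<le> 14 + 3 * card linked + card (H \<inter> triples (V - K - linked))"
proof -
  have "(\<Sum>v\<in>linked. card (link v)) \<le> 3 * card linked"
    by (rule sum_le_if_pair_sums_le) (use finite_V assms card_link_sum in \<open>auto simp: linked_def\<close>)
  moreover have "linked \<noteq> {}" using assms by auto
  ultimately show ?thesis using card_H_le card_inside_K by linarith
qed

end

subsection \<open>Loose-path-free 3-graphs that are not stars\<close>

text \<open>A star has at most 15 edges. If there is a triangle, the seventh vertex is either
  unlinked, leaving at most the 20 triples of \<open>K\<close>, or linked, giving at most 14 +
  6.\<close>

lemma loose_path_free_7_bound:
  assumes "finite V" "H \<subseteq> triples V" "\<not> loose_path H" "card V = 7"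
  shows "card H \<le> 20"
proof (cases "triangle_free H")
  case True
  show ?thesis
  proof (cases "star_in V H")
    case True
    then show ?thesis using star_bound[OF assms(1,2)] assms(4) by (simp add: choose_two)
  next
    case False
    then show ?thesis using triangle_free_bound[OF assms(1-3) True] assms(4)
      by (simp add: nonstar_bound_def)
  qed
next
  case False
  then obtain x1 x2 x3 y1 y2 y3 where tri: "triangle H x1 x2 x3 y1 y2 y3"
    by (auto simp: triangle_free_def)
  then interpret triangle_config V H x1 x2 x3 y1 y2 y3
    using assms by unfold_locales auto
  have fin: "finite (V - K - linked)" using assms(1) by simp
  have one: "card (V - K - linked) + card linked = 1" using card_outside assms(4) by simp
  have "card (H \<inter> triples (V - K - linked)) \<le> card (V - K - linked) choose 3"
    by (rule card_Int_triples_le[OF fin])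
  moreover have "card (V - K - linked) choose 3 = 0" using one by simp
  ultimately have Z: "card (H \<inter> triples (V - K - linked)) = 0" by simp
  consider "card linked = 0" | "card linked = 1" using one by linarith
  then show ?thesis
  proof cases
    case 1
    then have "linked = {}" using finite_V by (simp add: linked_def)
    then have "card H \<le> card (H \<inter> triples K)" using card_H_le Z by simp
    also have "\<dots> \<le> 20" using card_Int_triples_le[OF finite_K, of H] card_K by (simp add: choose_three)
    finally show ?thesis .
  next
    case 2
    then show ?thesis using card_H_le_if_one_link Z by simp
  qed
qed

text \<open>If there is a triangle, let \<open>y\<close> count the linked and \<open>z\<close> the
  unlinked vertices outside \<open>K\<close>. The edge counts by links fit the bound unless
  \<open>y = 0\<close> and \<open>z = 6\<close>; there the absence of links splits the 3-graph along
  \<open>K\<close>.\<close>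

lemma loose_path_free_nonstar_cases:
  assumes fin: "finite V" and sub: "H \<subseteq> triples V" and P: "\<not> loose_path H"
    and n: "8 \<le> card V" "card V \<le> 13" and star: "\<not> star_in V H"
  shows "card H \<le> nonstar_bound (card V) \<or>
    card V = 12 \<and> (\<exists>A\<subseteq>V. card A = 6 \<and> H \<subseteq> triples A \<union> triples (V - A))"
proof (cases "triangle_free H")
  case True
  then show ?thesis using triangle_free_bound[OF fin sub P True _ n(2) star] n(1) by simp
next
  case False
  then obtain x1 x2 x3 y1 y2 y3 where tri: "triangle H x1 x2 x3 y1 y2 y3"
    by (auto simp: triangle_free_def)
  then interpret triangle_config V H x1 x2 x3 y1 y2 y3
    using fin sub P by unfold_locales auto
  define y where "y = card linked"
  define z where "z = card (V - K - linked)"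
  define h where "h = card (H \<inter> triples (V - K - linked))"
  have yz: "z + y + 6 = card V" using card_outside by (simp add: y_def z_def)
  have h: "h \<le> z * (z - 1) * (z - 2) div 6"
    using card_Int_triples_le[of "V - K - linked" H] fin by (simp add: h_def z_def choose_three)
  \<comment> \<open>For thirteen vertices and no links, all 35 triples on the seven outside vertices
    would be too many.\<close>
  have h7: "h \<le> 20" if "z = 7"
    unfolding h_def
  proof (rule loose_path_free_7_bound)
    show "\<not> loose_path (H \<inter> triples (V - K - linked))" using P loose_path_mono by blast
  qed (use fin that z_def in auto)
  consider "y = 0" | "y = 1" | "y \<ge> 2" by linarith
  then show ?thesis
  proof cases
    case 1
    then have linked: "linked = {}" using fin by (simp add: y_def linked_def)
    have "card H \<le> card (H \<inter> triples K) + h" using card_H_le linked by (simp add: h_def)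
    moreover have "card (H \<inter> triples K) \<le> 20"
      using card_Int_triples_le[OF finite_K, of H] card_K by (simp add: choose_three)
    ultimately have H: "card H \<le> 20 + h" by linarith
    show ?thesis
    proof (cases "card V = 12")
      case True
      then show ?thesis using split_if_no_links[OF linked] K_sub card_K by blast
    next
      case False
      then have "z = 2 \<or> z = 3 \<or> z = 4 \<or> z = 5 \<or> z = 7" using yz n 1 by linarith
      moreover have cV: "card V = z + 6" using yz 1 by simp
      ultimately have "card H \<le> nonstar_bound (card V)"
        unfolding cV using H h h7 by (elim disjE) (simp_all add: nonstar_bound_def)
      then show ?thesis ..
    qed
  next
    case 2
    then have H: "card H \<le> 20 + h" using card_H_le_if_one_link by (simp add: y_def h_def)
    have "z = 1 \<or> z = 2 \<or> z = 3 \<or> z = 4 \<or> z = 5 \<or> z = 6" using yz n 2 by linarith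
    moreover have cV: "card V = z + 7" using yz 2 by simp
    ultimately have "card H \<le> nonstar_bound (card V)"
      unfolding cV using H h by (elim disjE) (simp_all add: nonstar_bound_def)
    then show ?thesis ..
  next
    case 3
    then have H: "card H \<le> 14 + 3 * y + h" using card_H_le_if_links by (simp add: y_def h_def)
    have "z = 0 \<or> z = 1 \<or> z = 2 \<or> z = 3 \<or> z = 4 \<or> z = 5" using yz n 3 by linarith
    \<comment> \<open>As \<open>z \<le> 5\<close>, the total is at most
      \<open>14 + 3 * (y + z)\<close>, which is \<open>3 * card V - 4\<close>.\<close>
    then have "h \<le> 2 * z" using h by auto
    then have "card H + 4 \<le> 3 * card V" using H yz by linarith
    moreover have "3 * card V \<le> nonstar_bound (card V) + 4"
      using n by (auto simp: nonstar_bound_def)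
    ultimately have "card H \<le> nonstar_bound (card V)" by linarith
    then show ?thesis ..
  qed
qed

section \<open>Splits of twelve vertices into two sixes\<close>

lemma crossing_triples_le_18:
  assumes A: "finite A" "card A = 6" and PQ: "P \<inter> Q = {}" "A \<subseteq> P \<union> Q"
  shows "card (triples A - (triples P \<union> triples Q)) \<le> 18"
proof -
  have fin: "finite (A \<inter> P)" "finite (A \<inter> Q)" using A by auto
  have finT: "finite (triples A)" using finite_triples[OF A(1)] .
  have "(A \<inter> P) \<union> (A \<inter> Q) = A" using PQ(2) by blast
  then have sum6: "card (A \<inter> P) + card (A \<inter> Q) = 6"
    using card_Un_disjoint[OF fin] PQ(1) A(2) by (metis inf_assoc inf_bot_right inf_left_commute)
  have ge: "triples (A \<inter> P) \<union> triples (A \<inter> Q) \<subseteq> triples A" by (auto simp: triples_def)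
  have "triples (A \<inter> P) \<inter> triples (A \<inter> Q) = {}"
  proof (rule ccontr)
    assume "triples (A \<inter> P) \<inter> triples (A \<inter> Q) \<noteq> {}"
    then obtain e where "e \<subseteq> P" "e \<subseteq> Q" "card e = 3" by (auto simp: triples_def)
    then have "e = {}" "card e = 3" using PQ(1) by auto
    then show False by simp
  qed
  then have "card (triples (A \<inter> P) \<union> triples (A \<inter> Q)) = (card (A \<inter> P) choose 3) + (card (A \<inter> Q) choose 3)"
    using fin by (simp add: card_Un_disjoint finite_triples card_triples)
  \<comment> \<open>The minimum over all ways to divide six vertices is attained at 3 + 3.\<close>
  moreover have "(card (A \<inter> P) choose 3) + (card (A \<inter> Q) choose 3) \<ge> 2"
  proof -
    have q: "card (A \<inter> Q) = 6 - card (A \<inter> P)" using sum6 by simp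
    have "card (A \<inter> P) = 0 \<or> card (A \<inter> P) = 1 \<or> card (A \<inter> P) = 2 \<or> card (A \<inter> P) = 3 \<or>
      card (A \<inter> P) = 4 \<or> card (A \<inter> P) = 5 \<or> card (A \<inter> P) = 6" using sum6 by linarith
    then show ?thesis unfolding q by (elim disjE) (simp_all add: choose_three)
  qed
  moreover have "card (triples A) = 20" using card_triples[OF A(1)] A(2) by (simp add: choose_three)
  moreover have "triples A - (triples P \<union> triples Q) = triples A - (triples (A \<inter> P) \<union> triples (A \<inter> Q))"
    by (auto simp: triples_def)
  moreover have "card (triples A - (triples (A \<inter> P) \<union> triples (A \<inter> Q)))
      = card (triples A) - card (triples (A \<inter> P) \<union> triples (A \<inter> Q))"
    using ge finT finite_subset by (intro card_Diff_subset) auto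
  ultimately show ?thesis by simp
qed

text \<open>Fix a vertex \<open>x\<close>. Of the ten triples through \<open>x, y\<close> each split covers at most four, so \<open>y\<close> is on the
  side of \<open>x\<close> in at least three splits; but 11 times 3 exceeds 6 times 5.\<close>

lemma not_all_split:
  fixes A :: "'c \<Rightarrow> 'a set"
  assumes V: "finite V" "card V = 12" and C: "finite C" "card C = 6"
    and col: "\<And>e. e \<in> triples V \<Longrightarrow> c e \<in> C"
    and A: "\<And>i. i \<in> C \<Longrightarrow> A i \<subseteq> V \<and> card (A i) = 6 \<and> {e \<in> triples V. c e = i} \<subseteq> triples (A i) \<union> triples (V - A i)"
  shows False
proof -
  obtain x where x: "x \<in> V" using V by fastforce
  \<comment> \<open>The side of the split that contains \<open>x\<close>; it contains every triple
    of colour \<open>i\<close> through \<open>x\<close>.\<close>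
  define B where "B i = (if x \<in> A i then A i else V - A i)" for i
  have B: "B i \<subseteq> V" "card (B i) = 6" "x \<in> B i" "finite (B i)" if "i \<in> C" for i
  proof -
    have "finite (A i)" using A[OF that] V(1) finite_subset by blast
    then show "B i \<subseteq> V" "card (B i) = 6" "x \<in> B i" "finite (B i)"
      using A[OF that] V x by (auto simp: B_def card_Diff_subset)
  qed
  have inB: "e \<subseteq> B (c e)" if e: "e \<in> triples V" "x \<in> e" for e
  proof -
    have "e \<in> triples (A (c e)) \<union> triples (V - A (c e))" using A[OF col[OF e(1)]] e(1) by blast
    then show ?thesis using e(2) by (auto simp: B_def triples_def)
  qed
  have "3 \<le> card {i \<in> C. y \<in> B i}" if y: "y \<in> V - {x}" for y
  proof -
    define M where "M = {i \<in> C. y \<in> B i}"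
    have finM: "finite M" using C by (simp add: M_def)
    have "V - {x, y} \<subseteq> (\<Union>i\<in>M. B i - {x, y})"
    proof
      fix z assume z: "z \<in> V - {x, y}"
      then have T: "{x, y, z} \<in> triples V" using x y by (auto simp: triples_def)
      have "c {x, y, z} \<in> M" "z \<in> B (c {x, y, z})" using inB[OF T] col[OF T] by (auto simp: M_def)
      then show "z \<in> (\<Union>i\<in>M. B i - {x, y})" using z by auto
    qed
    moreover have finU: "finite (\<Union>i\<in>M. B i - {x, y})" using finM B(4) by (auto simp: M_def)
    ultimately have "card (V - {x, y}) \<le> card (\<Union>i\<in>M. B i - {x, y})" by (intro card_mono)
    also have "\<dots> \<le> (\<Sum>i\<in>M. card (B i - {x, y}))" by (rule card_UN_le[OF finM])
    also have "\<dots> = (\<Sum>i\<in>M. 4)"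
    proof (rule sum.cong[OF refl])
      fix i assume "i \<in> M"
      then have i: "i \<in> C" "y \<in> B i" by (auto simp: M_def)
      have "card (B i - {x, y}) = card (B i) - card {x, y}"
        by (rule card_Diff_subset) (use B(3)[OF i(1)] i(2) in auto)
      then show "card (B i - {x, y}) = 4" using B(2)[OF i(1)] y by auto
    qed
    finally have "card (V - {x, y}) \<le> card M * 4" by simp
    moreover have "card (V - {x, y}) = card V - card {x, y}"
      by (rule card_Diff_subset) (use x y in auto)
    moreover have "card {x, y} = 2" using y by auto
    ultimately show ?thesis using V(2) by (simp add: M_def)
  qed
  then have "(\<Sum>y\<in>V - {x}. 3) \<le> (\<Sum>y\<in>V - {x}. card {i \<in> C. y \<in> B i})" by (rule sum_mono)
  also have "\<dots> = 5 * card C"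
  proof (rule sum_multicount)
    show "\<forall>i\<in>C. card {y \<in> V - {x}. y \<in> B i} = 5"
    proof
      fix i assume i: "i \<in> C"
      have "{y \<in> V - {x}. y \<in> B i} = B i - {x}" using B(1)[OF i] by blast
      then show "card {y \<in> V - {x}. y \<in> B i} = 5" using B(2,3)[OF i] by simp
    qed
  qed (use V C in auto)
  finally show False using V C x by simp
qed

subsection \<open>Colourings\<close>

abbreviation colour_class :: "'a set \<Rightarrow> ('a set \<Rightarrow> 'c) \<Rightarrow> 'c \<Rightarrow> 'a set set" where
  "colour_class V c i \<equiv> {e \<in> triples V. c e = i}"

lemma sum_card_colour_classes:
  assumes "finite V" "finite C" "\<And>e. e \<in> X \<Longrightarrow> c e \<in> C" "X \<subseteq> triples V"
  shows "card X = (\<Sum>i\<in>C. card {e \<in> X. c e = i})"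
proof -
  have "finite X" using assms finite_triples finite_subset by blast
  moreover have "\<forall>e\<in>X. card {i \<in> C. c e = i} = 1"
  proof
    fix e assume "e \<in> X"
    then have "{i \<in> C. c e = i} = {c e}" using assms(3) by auto
    then show "card {i \<in> C. c e = i} = 1" by simp
  qed
  ultimately show ?thesis
    using sum_multicount[OF assms(2), of X "\<lambda>i e. c e = i" 1] by simp
qed

text \<open>Since 6 * 35 < 220, some colour \<open>i0\<close> splits along a six-set
  \<open>A0\<close>. At least 180 triples cross \<open>A0\<close>, and none has colour
  \<open>i0\<close>. Each other colour takes at most 36 of them: 18 on either side if it splits, 35
  in all if it does not. This is tight, so all six colours split, contradicting
  \<open>not_all_split\<close>.\<close>

lemma star_or_loose_path_12:
  assumes V: "finite V" "card V = 12" and C: "finite C" "card C = 6"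
    and col: "\<And>e. e \<in> triples V \<Longrightarrow> c e \<in> C"
    and P: "\<And>i. i \<in> C \<Longrightarrow> \<not> loose_path (colour_class V c i)"
    and star: "\<And>i. i \<in> C \<Longrightarrow> \<not> star_in V (colour_class V c i)"
  shows False
proof -
  define split where "split i A \<longleftrightarrow> A \<subseteq> V \<and> card A = 6 \<and> colour_class V c i \<subseteq> triples A \<union> triples (V - A)" for i A
  have finT: "finite (triples V)" using finite_triples[OF V(1)] .
  have cT: "card (triples V) = 220" using card_triples[OF V(1)] V(2) by (simp add: choose_three)
  have alt: "card (colour_class V c i) \<le> 35 \<or> (\<exists>A. split i A)" if i: "i \<in> C" for i
    using loose_path_free_nonstar_cases[OF V(1) _ P[OF i] _ _ star[OF i]] V(2)
    by (auto simp: split_def nonstar_bound_def)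
  have "\<exists>i\<in>C. \<exists>A. split i A"
  proof (rule ccontr)
    assume "\<not> ?thesis"
    then have "card (colour_class V c i) \<le> 35" if "i \<in> C" for i using alt that by blast
    then have "(\<Sum>i\<in>C. card (colour_class V c i)) \<le> card C * 35"
      using sum_bounded_above[of C "\<lambda>i. card (colour_class V c i)" 35] by simp
    then show False
      using sum_card_colour_classes[OF V(1) C(1) col order_refl] cT C(2) by simp
  qed
  then obtain i0 A0 where i0: "i0 \<in> C" "split i0 A0" by blast
  have A0: "A0 \<subseteq> V" "card A0 = 6" "finite A0"
    and c0: "colour_class V c i0 \<subseteq> triples A0 \<union> triples (V - A0)"
    using i0(2) V(1) finite_subset by (auto simp: split_def)
  have cVA: "card (V - A) = 6" "finite (V - A)" if "A \<subseteq> V" "card A = 6" for A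
    using that V finite_subset[OF that(1) V(1)] by (simp_all add: card_Diff_subset)
  define X where "X = triples V - (triples A0 \<union> triples (V - A0))"
  have "card X \<ge> 180"
  proof -
    have "card (triples A0 \<union> triples (V - A0)) \<le> card (triples A0) + card (triples (V - A0))"
      by (rule card_Un_le)
    also have "\<dots> = 40"
      using card_triples[OF A0(3)] A0(2) card_triples[of "V - A0"] cVA[OF A0(1,2)]
      by (simp add: choose_three)
    finally have "card (triples A0 \<union> triples (V - A0)) \<le> 40" .
    moreover have "card (triples V) - card (triples A0 \<union> triples (V - A0)) \<le> card X"
      unfolding X_def using A0 V(1) by (intro diff_card_le_card_Diff) (simp add: finite_triples)
    ultimately show ?thesis using cT by linarith
  qed
  moreover have cX: "card X = (\<Sum>i\<in>C. card {e \<in> X. c e = i})"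
    by (rule sum_card_colour_classes[OF V(1) C(1)]) (auto simp: X_def col)
  moreover have "{e \<in> X. c e = i0} = {}" using c0 by (auto simp: X_def)
  ultimately have sum180: "180 \<le> (\<Sum>i\<in>C - {i0}. card {e \<in> X. c e = i})"
    using sum.remove[OF C(1) i0(1), of "\<lambda>i. card {e \<in> X. c e = i}"] by simp
  have le36: "card {e \<in> X. c e = i} \<le> 36" if i: "i \<in> C" for i
    using alt[OF i]
  proof
    assume "card (colour_class V c i) \<le> 35"
    moreover have "card {e \<in> X. c e = i} \<le> card (colour_class V c i)"
      using finT by (intro card_mono) (auto simp: X_def)
    ultimately show ?thesis by linarith
  next
    assume "\<exists>A. split i A"
    then obtain A where A: "A \<subseteq> V" "card A = 6" "colour_class V c i \<subseteq> triples A \<union> triples (V - A)"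
      by (auto simp: split_def)
    let ?N = "triples A0 \<union> triples (V - A0)"
    have finA: "finite A" using A(1) V(1) finite_subset by blast
    have "{e \<in> X. c e = i} \<subseteq> (triples A - ?N) \<union> (triples (V - A) - ?N)"
      using A(3) by (auto simp: X_def)
    then have "card {e \<in> X. c e = i} \<le> card ((triples A - ?N) \<union> (triples (V - A) - ?N))"
      using finA V(1) by (intro card_mono) (auto simp: finite_triples)
    also have "\<dots> \<le> card (triples A - ?N) + card (triples (V - A) - ?N)" by (rule card_Un_le)
    also have "card (triples A - ?N) \<le> 18"
      by (rule crossing_triples_le_18) (use A finA in auto)
    also have "card (triples (V - A) - ?N) \<le> 18"
      by (rule crossing_triples_le_18) (use cVA[OF A(1,2)] in auto)
    finally show ?thesis by simp
  qed
  \<comment> \<open>A colour without a split would leave room for only 35 + 4 * 36 = 179 crossing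
    triples.\<close>
  have "\<exists>A. split i A" if i: "i \<in> C" for i
  proof (rule ccontr)
    assume no: "\<nexists>A. split i A"
    then have ne: "i \<noteq> i0" using i0(2) by blast
    have "card (colour_class V c i) \<le> 35" using alt[OF i] no by blast
    moreover have "card {e \<in> X. c e = i} \<le> card (colour_class V c i)"
      using finT by (intro card_mono) (auto simp: X_def)
    ultimately have "card {e \<in> X. c e = i} \<le> 35" by linarith
    moreover have "(\<Sum>j\<in>C - {i0} - {i}. card {e \<in> X. c e = j}) \<le> card (C - {i0} - {i}) * 36"
      using sum_bounded_above[of "C - {i0} - {i}" "\<lambda>j. card {e \<in> X. c e = j}" 36] le36 by simp
    moreover have "card (C - {i0} - {i}) = 4" using C i i0(1) ne by simp
    moreover have "(\<Sum>j\<in>C - {i0}. card {e \<in> X. c e = j})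
        = card {e \<in> X. c e = i} + (\<Sum>j\<in>C - {i0} - {i}. card {e \<in> X. c e = j})"
      using C(1) i ne by (intro sum.remove) auto
    ultimately show False using sum180 by simp
  qed
  then obtain A where A: "split i (A i)" if "i \<in> C" for i by metis
  show False
    by (rule not_all_split[OF V C col, where A = A]) (use A in \<open>auto simp: split_def\<close>)
qed

lemma monochromatic_loose_path:
  fixes C :: "'c set" and V :: "'a set"
  assumes "1 \<le> r" "r \<le> 7" "finite V" "card V = r + 6" "finite C" "card C = r"
    and "\<And>e. e \<in> triples V \<Longrightarrow> c e \<in> C"
  shows "\<exists>i\<in>C. loose_path (colour_class V c i)"
  using assms
proof (induction r arbitrary: V C rule: nat_induct_at_least)
  case base
  then obtain i where C: "C = {i}" by (auto simp: card_1_singleton_iff)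
  then have "colour_class V c i = triples V" using base by auto
  moreover have "card (triples V) = 35" using base card_triples[of V] by (simp add: choose_three)
  ultimately show ?case using loose_path_free_7_bound[of V "triples V"] base C by (cases "loose_path (triples V)") auto
next
  case (Suc r)
  show ?case
  proof (rule ccontr)
    assume "\<not> ?case"
    then have P: "\<not> loose_path (colour_class V c i)" if "i \<in> C" for i using that by blast
    note fin = Suc.prems(2) and cV = Suc.prems(3) and C = Suc.prems(4,5) and col = Suc.prems(6)
    have star: "\<not> star_in V (colour_class V c i)" if i: "i \<in> C" for i
    proof
      assume "star_in V (colour_class V c i)"
      then obtain v where v: "v \<in> V" "\<And>e. e \<in> triples V \<Longrightarrow> c e = i \<Longrightarrow> v \<in> e"
        by (auto simp: star_in_def)
      \<comment> \<open>Deleting the centre \<open>v\<close> destroys colour \<open>i\<close>,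
        leaving \<open>r\<close> colours on \<open>r + 6\<close> vertices.\<close>
      have "\<exists>j\<in>C - {i}. loose_path (colour_class (V - {v}) c j)"
      proof (rule Suc.IH)
        fix e assume e: "e \<in> triples (V - {v})"
        then have "e \<in> triples V" "v \<notin> e" by (auto simp: triples_def)
        then show "c e \<in> C - {i}" using col v(2) by auto
      qed (use Suc.prems i v(1) in auto)
      then obtain j where j: "j \<in> C" "loose_path (colour_class (V - {v}) c j)" by blast
      have "colour_class (V - {v}) c j \<subseteq> colour_class V c j" by (auto simp: triples_def)
      then show False using loose_path_mono[OF j(2)] P[OF j(1)] by blast
    qed
    have r: "r = 1 \<or> r = 2 \<or> r = 3 \<or> r = 4 \<or> r = 5 \<or> r = 6" using Suc.hyps Suc.prems(1) by linarith
    show False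
    proof (cases "r = 5")
      case True
      then show False using star_or_loose_path_12[OF fin _ C(1) _ col P star] cV C(2) by simp
    next
      case False
      have le: "card (colour_class V c i) \<le> nonstar_bound (r + 7)" if i: "i \<in> C" for i
        using loose_path_free_nonstar_cases[OF fin _ P[OF i] _ _ star[OF i]] cV r False by auto
      have "card (triples V) = (\<Sum>i\<in>C. card (colour_class V c i))"
        by (rule sum_card_colour_classes[OF fin C(1) col order_refl])
      also have "\<dots> \<le> card C * nonstar_bound (r + 7)"
        using sum_bounded_above[of C "\<lambda>i. card (colour_class V c i)"] le by simp
      finally have "(r + 7) choose 3 \<le> Suc r * nonstar_bound (r + 7)"
        using card_triples[OF fin] cV C(2) by (simp add: add.commute)
      \<comment> \<open>56 > 2 * 27, 84 > 3 * 27, 120 > 4 * 29, 165 > 5 * 32 and 286 > 7 *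
        40.\<close>
      then show False using r False
        by (elim disjE) (simp_all add: choose_three nonstar_bound_def)
    qed
  qed
qed

section \<open>Transfer to the given definitions, and the lower bound\<close>

lemma mono_P_if_loose_path:
  assumes "loose_path (colour_class {..<n} c i)"
  shows "mono_P n c"
proof -
  obtain a b u d v f g where *: "distinct [a, b, u, d, v, f, g]"
    "{a, b, u} \<in> colour_class {..<n} c i" "{u, d, v} \<in> colour_class {..<n} c i"
    "{v, f, g} \<in> colour_class {..<n} c i"
    using assms unfolding loose_path_def by blast
  then have "set [a, b, u, d, v, f, g] \<subseteq> {..<n}" by (auto simp: triples_def)
  moreover have "c {a, b, u} = c {u, d, v} \<and> c {u, d, v} = c {v, f, g}" using * by simp
  ultimately show ?thesis unfolding mono_P_def using *(1) by blast
qed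

lemma no_mono_P_min_colouring:
  assumes "1 \<le> r" "n < r + 6"
  shows "\<not> mono_P n (\<lambda>e. min (Min e) (r - 1))"
proof
  assume "mono_P n (\<lambda>e. min (Min e) (r - 1))"
  then obtain a b u d v f g where *: "distinct [a, b, u, d, v, f, g]" "set [a, b, u, d, v, f, g] \<subseteq> {..<n}"
    "min (Min {a, b, u}) (r - 1) = min (Min {u, d, v}) (r - 1)"
    "min (Min {u, d, v}) (r - 1) = min (Min {v, f, g}) (r - 1)"
    unfolding mono_P_def by blast
  show False
  proof (cases "Min {a, b, u} < r - 1")
    case True
    \<comment> \<open>Below the cap, colours are least vertices, but the first and the last edge of
      the path are disjoint.\<close>
    then have "Min {a, b, u} = Min {v, f, g}" using *(3,4) by linarith
    moreover have "Min {a, b, u} \<in> {a, b, u}" "Min {v, f, g} \<in> {v, f, g}" by (rule Min_in; simp)+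
    ultimately have "Min {a, b, u} \<in> {a, b, u} \<inter> {v, f, g}" by simp
    moreover have "{a, b, u} \<inter> {v, f, g} = {}" using *(1) by auto
    ultimately show False by blast
  next
    case False
    then have "r - 1 \<le> Min {a, b, u}" "r - 1 \<le> Min {u, d, v}" "r - 1 \<le> Min {v, f, g}"
      using *(3,4) by linarith+
    \<comment> \<open>All seven vertices would lie in an interval of at most six numbers.\<close>
    then have "set [a, b, u, d, v, f, g] \<subseteq> {r - 1..<n}" using *(2) by auto
    then have "card (set [a, b, u, d, v, f, g]) \<le> card {r - 1..<n}" by (rule card_mono[rotated]) simp
    moreover have "card (set [a, b, u, d, v, f, g]) = 7" using distinct_card[OF *(1)] by simp
    ultimately show False using assms by simp
  qed
qed

theorem theorem1:
  fixes r :: nat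
  assumes "1 \<le> r" and "r \<le> 7"
  shows "ramsey_P r = r + 6"
  unfolding ramsey_P_def
proof (rule Least_equality)
  have eT: "edges3 n = triples {..<n}" for n by (simp add: edges3_def triples_def)
  show "\<forall>col. colouring (r + 6) r col \<longrightarrow> mono_P (r + 6) col"
  proof (intro allI impI)
    fix col assume "colouring (r + 6) r col"
    then have "\<exists>i\<in>{..<r}. loose_path (colour_class {..<r + 6} col i)"
      by (intro monochromatic_loose_path[OF assms]) (auto simp: colouring_def eT)
    then show "mono_P (r + 6) col" using mono_P_if_loose_path by blast
  qed
  \<comment> \<open>\<open>LEAST\<close> calls for a counterexample at every smaller
    \<open>n\<close>; the same formula serves all of them.\<close>
  fix n assume n: "\<forall>col. colouring n r col \<longrightarrow> mono_P n col"
  show "r + 6 \<le> n"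
  proof (rule ccontr)
    assume "\<not> r + 6 \<le> n"
    then have "\<not> mono_P n (\<lambda>e. min (Min e) (r - 1))" using no_mono_P_min_colouring assms by simp
    moreover have "colouring n r (\<lambda>e. min (Min e) (r - 1))" using assms by (auto simp: colouring_def)
    ultimately show False using n by blast
  qed
qed

end
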